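(* Let $S(K,L^2)=(G_K\backslash M)\times S(L^2)$, where $S(L^2)$ is the set of two-element subsets of $G_L\backslash M$. There are exactly four orbits of the action of $M$ by right multiplication (elementwise) on $S(K,L^2)$. Representatives and lengths (cardinalities) of the orbits are given by: Orbit 1: representative $(p_0,\{6,5\})$, length $480$; Orbit 2: representative $(p_0,\{\overline{6},5\})$, length $960$; Orbit 3: representative $(p_0,\{6,\overline{6}\})$, length $192$; Orbit 4: representative $(p_0,\{\overline{1},\overline{2}\})$, length $480$.
   Context: $V=\{(a,b,c,d,e,f,g)^T\in\mathbb{C}^7: e+f+g-a-b-c-d=1\}$, and $\vec{x}=(a,b,c,d,e,f,g)^T$ denotes a point of $V$. Permutations in $S_7$ are identified with permutation matrices in $GL(7,\mathbb{C})$ (acting on the standard basis of $\mathbb{C}^7$). Let $A_0\in GL(7,\mathbb{C})$ be the matrix with $A_0(a,b,c,d,e,f,g)^T=(a,b,g-c,g-d,e+g-c-d,f+g-c-d,g)^T$. Put $M=\langle(12),(23),(34),(56),(67),A_0\rangle$ (order $23040$, preserving $V$; an element of $M$ is determined by its action on $V$), $G_K=\langle(23),(34),(56),(67),A_0\rangle$ (order $720$), $G_L=\langle(12),(23),(34),(67),A_0\rangle$ (order $1920$). $G_K\backslash M$ and $G_L\backslash M$ are the sets of right cosets, of sizes $32$ and $12$, on which $M$ acts by right multiplication. $p_0\in G_K\backslash M$ is the coset $G_K$ itself. The $12$ elements of $G_L\backslash M$ are labelled $1,\dots,6,\overline{1},\dots,\overline{6}$: each label denotes the right coset of $G_L$ containing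 the element of $M$ which acts on $V$ by sending $\vec{x}$ to 6: $(a,b,c,d,e,f,g)^T$; 5: $(a,b,c,d,f,e,g)^T$; 4: $(a,b,c,d,g,f,e)^T$; 3: $(a,1+a-e,1+a-f,1+a-g,1+a-b,1+a-c,1+a-d)^T$; 2: $(a,1+a-e,1+a-f,1+a-g,1+a-c,1+a-b,1+a-d)^T$; 1: $(a,1+a-e,1+a-f,1+a-g,1+a-d,1+a-c,1+a-b)^T$; $\overline{6}$: $(1-a,1-b,1-c,1-d,2-e,2-f,2-g)^T$; $\overline{5}$: $(1-a,1-b,1-c,1-d,2-f,2-e,2-g)^T$; $\overline{4}$: $(1-a,1-b,1-c,1-d,2-g,2-f,2-e)^T$; $\overline{3}$: $(1-a,e-a,f-a,g-a,1+b-a,1+c-a,1+d-a)^T$; $\overline{2}$: $(1-a,e-a,f-a,g-a,1+c-a,1+b-a,1+d-a)^T$; $\overline{1}$: $(1-a,e-a,f-a,g-a,1+d-a,1+c-a,1+b-a)^T$. *)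

theory Defs
  imports "HOL-Analysis.Analysis" "HOL-Algebra.Group_Action" "HOL-Algebra.Generated_Groups"
begin

text \<open>
  The index type \<open>7\<close> is the type of integers modulo 7, so its elements are \<open>1, \<dots>, 6\<close> and
  \<open>7 = 0\<close>; \<^const>\<open>vector\<close> fills the coordinates in the order \<open>1, \<dots>, 7\<close>.
\<close>

type_synonym vec7 = "complex ^ 7"
type_synonym mat7 = "complex ^ 7 ^ 7"

lemma vector_7:
  "(vector [a, b, c, d, e, f, g] :: vec7) $ 1 = a"
  "(vector [a, b, c, d, e, f, g] :: vec7) $ 2 = b"
  "(vector [a, b, c, d, e, f, g] :: vec7) $ 3 = c"
  "(vector [a, b, c, d, e, f, g] :: vec7) $ 4 = d"
  "(vector [a, b, c, d, e, f, g] :: vec7) $ 5 = e"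
  "(vector [a, b, c, d, e, f, g] :: vec7) $ 6 = f"
  "(vector [a, b, c, d, e, f, g] :: vec7) $ 7 = g"
  by (simp_all add: vector_def)

definition on_coords ::
    "(complex \<Rightarrow> complex \<Rightarrow> complex \<Rightarrow> complex \<Rightarrow> complex \<Rightarrow> complex \<Rightarrow> complex \<Rightarrow> 'r) \<Rightarrow> vec7 \<Rightarrow> 'r"
  where "on_coords F x = F (x $ 1) (x $ 2) (x $ 3) (x $ 4) (x $ 5) (x $ 6) (x $ 7)"

definition V :: "vec7 set"
  where "V = {x. on_coords (\<lambda>a b c d e f g. e + f + g - a - b - c - d = 1) x}"

definition GL7 :: "mat7 monoid"
  where "GL7 = \<lparr>carrier = {A. invertible A}, mult = (**), one = mat 1\<rparr>"

lemma group_GL7: "group GL7"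
proof (rule groupI)
  fix A assume "A \<in> carrier GL7"
  then obtain B where "A ** B = mat 1" "B ** A = mat 1"
    by (auto simp: GL7_def invertible_def)
  then show "\<exists>B\<in>carrier GL7. B \<otimes>\<^bsub>GL7\<^esub> A = \<one>\<^bsub>GL7\<^esub>"
    by (auto simp: GL7_def invertible_def intro!: bexI[of _ B])
qed (auto simp: GL7_def invertible_mult matrix_mul_assoc intro: invertible_def[THEN iffD2, OF exI[of _ "mat 1"]])

text \<open>The permutation matrix of \<open>\<sigma>\<close> maps the standard basis vector \<open>e\<^sub>j\<close> to \<open>e\<^bsub>\<sigma> j\<^esub>\<close>.\<close>

definition perm_matrix :: "(7 \<Rightarrow> 7) \<Rightarrow> mat7"
  where "perm_matrix \<sigma> = (\<chi> i j. if i = \<sigma> j then 1 else 0)"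

definition swap_matrix :: "7 \<Rightarrow> 7 \<Rightarrow> mat7"
  where "swap_matrix i j = perm_matrix (Transposition.transpose i j)"

definition A0 :: mat7
  where "A0 = matrix (on_coords (\<lambda>a b c d e f g.
           vector [a, b, g - c, g - d, e + g - c - d, f + g - c - d, g]))"

definition M :: "mat7 set"
  where "M = generate GL7 {swap_matrix 1 2, swap_matrix 2 3, swap_matrix 3 4,
                           swap_matrix 5 6, swap_matrix 6 7, A0}"

definition G_K :: "mat7 set"
  where "G_K = generate GL7 {swap_matrix 2 3, swap_matrix 3 4,
                             swap_matrix 5 6, swap_matrix 6 7, A0}"

definition G_L :: "mat7 set"
  where "G_L = generate GL7 {swap_matrix 1 2, swap_matrix 2 3, swap_matrix 3 4,
                             swap_matrix 6 7, A0}"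

definition M_group :: "mat7 monoid"
  where "M_group = GL7\<lparr>carrier := M\<rparr>"

definition p0 :: "mat7 set"
  where "p0 = G_K"

text \<open>The constructors \<open>Bar1, \<dots>, Bar6\<close> are the overlined labels.\<close>

datatype label =
  Lab1 | Lab2 | Lab3 | Lab4 | Lab5 | Lab6 | Bar1 | Bar2 | Bar3 | Bar4 | Bar5 | Bar6

primrec label_map :: "label \<Rightarrow> vec7 \<Rightarrow> vec7" where
  "label_map Lab6 = on_coords (\<lambda>a b c d e f g. vector [a, b, c, d, e, f, g])"
| "label_map Lab5 = on_coords (\<lambda>a b c d e f g. vector [a, b, c, d, f, e, g])"
| "label_map Lab4 = on_coords (\<lambda>a b c d e f g. vector [a, b, c, d, g, f, e])"
| "label_map Lab3 = on_coords (\<lambda>a b c d e f g.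
     vector [a, 1 + a - e, 1 + a - f, 1 + a - g, 1 + a - b, 1 + a - c, 1 + a - d])"
| "label_map Lab2 = on_coords (\<lambda>a b c d e f g.
     vector [a, 1 + a - e, 1 + a - f, 1 + a - g, 1 + a - c, 1 + a - b, 1 + a - d])"
| "label_map Lab1 = on_coords (\<lambda>a b c d e f g.
     vector [a, 1 + a - e, 1 + a - f, 1 + a - g, 1 + a - d, 1 + a - c, 1 + a - b])"
| "label_map Bar6 = on_coords (\<lambda>a b c d e f g.
     vector [1 - a, 1 - b, 1 - c, 1 - d, 2 - e, 2 - f, 2 - g])"
| "label_map Bar5 = on_coords (\<lambda>a b c d e f g.
     vector [1 - a, 1 - b, 1 - c, 1 - d, 2 - f, 2 - e, 2 - g])"
| "label_map Bar4 = on_coords (\<lambda>a b c d e f g.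
     vector [1 - a, 1 - b, 1 - c, 1 - d, 2 - g, 2 - f, 2 - e])"
| "label_map Bar3 = on_coords (\<lambda>a b c d e f g.
     vector [1 - a, e - a, f - a, g - a, 1 + b - a, 1 + c - a, 1 + d - a])"
| "label_map Bar2 = on_coords (\<lambda>a b c d e f g.
     vector [1 - a, e - a, f - a, g - a, 1 + c - a, 1 + b - a, 1 + d - a])"
| "label_map Bar1 = on_coords (\<lambda>a b c d e f g.
     vector [1 - a, e - a, f - a, g - a, 1 + d - a, 1 + c - a, 1 + b - a])"

text \<open>
  The maps above are affine. On \<^const>\<open>V\<close> the constant \<open>1\<close> equals the linear form
  \<open>e + f + g - a - b - c - d\<close>, which is how each of them is the restriction of a matrix in
  \<^const>\<open>M\<close>; that matrix is unique because \<^const>\<open>V\<close> spans the whole space.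
\<close>

definition M_element :: "(vec7 \<Rightarrow> vec7) \<Rightarrow> mat7"
  where "M_element \<phi> = (THE m. m \<in> M \<and> (\<forall>x\<in>V. m *v x = \<phi> x))"

definition labelled_coset :: "label \<Rightarrow> mat7 set"
  where "labelled_coset l = G_L #>\<^bsub>M_group\<^esub> M_element (label_map l)"

definition S_L2 :: "mat7 set set set"
  where "S_L2 = {X. X \<subseteq> rcosets\<^bsub>M_group\<^esub> G_L \<and> card X = 2}"

definition S_K_L2 :: "(mat7 set \<times> mat7 set set) set"
  where "S_K_L2 = (rcosets\<^bsub>M_group\<^esub> G_K) \<times> S_L2"

text \<open>
  This is a right action, whereas the library's \<open>group_action\<close> locale is about left actions;
  the definitions of \<^const>\<open>orbit\<close> and \<^const>\<open>orbits\<close> make sense for both.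
\<close>

definition right_mult ::
    "mat7 \<Rightarrow> mat7 set \<times> mat7 set set \<Rightarrow> mat7 set \<times> mat7 set set"
  where "right_mult m = (\<lambda>(p, X). (p #>\<^bsub>M_group\<^esub> m, (\<lambda>q. q #>\<^bsub>M_group\<^esub> m) ` X))"

definition M_orbit :: "mat7 set \<times> mat7 set set \<Rightarrow> (mat7 set \<times> mat7 set set) set"
  where "M_orbit = orbit M_group right_mult"

definition M_orbits :: "(mat7 set \<times> mat7 set set) set set"
  where "M_orbits = orbits M_group S_K_L2 right_mult"

end

theory Submission
  imports Defs
begin

text \<open>
  Six linear forms on the seven-dimensional space, one for each label \<open>1, \<dots>, 6\<close>, are permuted up to
  sign by \<^const>\<open>M\<close>, and this identifies \<^const>\<open>M\<close> with the Weyl group of type \<open>D\<^sub>6\<close>, i.e.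
  the signed permutations with an even number of sign changes. Under the identification
  \<^const>\<open>G_L\<close> is the stabilizer of the sixth form and \<^const>\<open>G_K\<close> is the stabilizer of the set of all
  six positive forms. Hence cosets of \<^const>\<open>G_L\<close> are signed indices, and cosets of \<^const>\<open>G_K\<close> are
  the 32 choices \<open>T\<close> of one sign for each index with an even number of minus signs. The orbit of
  a pair \<open>(T, X)\<close> is determined by whether \<open>X\<close> has two, one or no elements in \<open>T\<close> and, in the
  middle case, by whether these are opposite to each other; this gives \<open>15\<close>, \<open>30\<close>, \<open>6\<close> and \<open>15\<close>
  sets \<open>X\<close> for every \<open>T\<close>.
\<close>

section \<open>Even signed permutations of six axes\<close>

definition signed :: "(int \<Rightarrow> int) \<Rightarrow> int \<Rightarrow> int"
  where "signed f i = sgn i * f \<bar>i\<bar>"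

definition flip12 :: "int \<Rightarrow> int"
  where "flip12 k = (if k = 1 then - 2 else if k = 2 then - 1 else k)"

definition Idx :: "int set" where "Idx = {- 6..6} - {0}"
text \<open>
  The elements of \<^term>\<open>WD6\<close> are the Weyl group of type \<open>D\<^sub>6\<close>: the negative index \<open>- i\<close> stands
  for the opposite of the \<open>i\<close>-th axis, and an even number of signs is changed.
\<close>

definition WD6 :: "(int \<Rightarrow> int) set" where
  "WD6 = {\<pi>. \<pi> permutes Idx \<and> (\<forall>i. \<pi> (- i) = - \<pi> i) \<and> (\<Prod>i = 1..6. sgn (\<pi> i)) = 1}"

lemma finite_Idx: "finite Idx" by (simp add: Idx_def)

lemma abs_in_iff: "\<bar>i\<bar> \<in> {1..6} \<longleftrightarrow> i \<in> Idx"
  by (auto simp: Idx_def)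

lemma signed_pos: "i > 0 \<Longrightarrow> signed f i = f i"
  by (simp add: signed_def)

lemma signed_minus: "signed f (- i) = - signed f i"
  by (simp add: signed_def)

lemma abs_signed: "i \<noteq> 0 \<Longrightarrow> \<bar>signed f i\<bar> = \<bar>f \<bar>i\<bar>\<bar>"
  by (auto simp: signed_def abs_mult)

lemma odd_eqI:
  fixes f g :: "int \<Rightarrow> int"
  assumes "\<And>i. f (- i) = - f i" "\<And>i. g (- i) = - g i" "\<And>i. i > 0 \<Longrightarrow> f i = g i"
  shows "f = g"
proof
  fix i :: int
  show "f i = g i"
  proof (cases i "0::int" rule: linorder_cases)
    case less
    then show ?thesis using assms(1)[of "-i"] assms(2)[of "-i"] assms(3)[of "-i"] by simp
  next
    case equal
    then show ?thesis using assms(1)[of 0] assms(2)[of 0] by simp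
  next
    case greater
    then show ?thesis by (rule assms(3))
  qed
qed

lemma signed_comp:
  assumes "\<And>i. i > 0 \<Longrightarrow> g i > 0"
  shows "signed (f \<circ> g) = signed f \<circ> signed g"
  by (rule odd_eqI) (auto simp: signed_minus signed_pos assms)

lemma signed_in_WD6:
  assumes img: "(\<lambda>k. \<bar>f k\<bar>) ` {1..6} = {1..6}"
    and off: "\<And>k. k > 6 \<Longrightarrow> f k = k"
    and sgn: "(\<Prod>i = 1..6. sgn (f i)) = 1"
  shows "signed f \<in> WD6"
proof -
  have "signed f ` Idx = Idx"
  proof
    have "signed f i \<in> Idx" if "i \<in> Idx" for i
    proof -
      have "\<bar>f \<bar>i\<bar>\<bar> \<in> {1..6}" using img that abs_in_iff by blast
      moreover have "i \<noteq> 0" using that by (auto simp: Idx_def)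
      ultimately show ?thesis using abs_in_iff[of "signed f i"] abs_signed[of i f] by simp
    qed
    then show "signed f ` Idx \<subseteq> Idx" by blast
    show "Idx \<subseteq> signed f ` Idx"
    proof
      fix j assume j: "j \<in> Idx"
      then have "\<bar>j\<bar> \<in> (\<lambda>k. \<bar>f k\<bar>) ` {1..6}" by (simp only: img abs_in_iff)
      then obtain k where k: "k \<in> {1..6}" "\<bar>j\<bar> = \<bar>f k\<bar>" by blast
      then have "k \<in> Idx" "- k \<in> Idx" by (auto simp: Idx_def)
      moreover have "j = signed f k \<or> j = signed f (- k)"
        using k by (auto simp: signed_minus signed_pos abs_eq_iff)
      ultimately show "j \<in> signed f ` Idx" by blast
    qed
  qed
  then have "bij_betw (signed f) Idx Idx"
    by (simp add: bij_betw_def eq_card_imp_inj_on finite_Idx)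
  moreover have "signed f i = i" if "i \<notin> Idx" for i
  proof -
    have "i = 0 \<or> \<bar>i\<bar> > 6" using that by (auto simp: Idx_def)
    then show ?thesis by (auto simp: signed_def off sgn_mult_abs)
  qed
  ultimately have "signed f permutes Idx" by (rule bij_imp_permutes)
  moreover have "(\<Prod>i = 1..6. sgn (signed f i)) = (\<Prod>i = 1..6. sgn (f i))"
    by (intro prod.cong) (auto simp: signed_pos)
  ultimately show ?thesis using sgn by (simp add: WD6_def signed_minus)
qed

lemma signed_perm_in_WD6:
  assumes "\<sigma> permutes {1..6}"
  shows "signed \<sigma> \<in> WD6"
proof (rule signed_in_WD6)
  have pos: "\<sigma> k > 0" if "k \<in> {1..6}" for k
    using permutes_in_image[OF assms, of k] that by auto
  then have "(\<lambda>k. \<bar>\<sigma> k\<bar>) ` {1..6} = \<sigma> ` {1..6}" by (intro image_cong) (auto simp: less_imp_le)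
  then show "(\<lambda>k. \<bar>\<sigma> k\<bar>) ` {1..6} = {1..6}" using permutes_image[OF assms] by simp
  show "\<sigma> k = k" if "k > 6" for k using permutes_not_in[OF assms] that by simp
  show "(\<Prod>i = 1..6. sgn (\<sigma> i)) = 1" using pos by (intro prod.neutral) auto
qed

lemma WD6_minus: "\<pi> \<in> WD6 \<Longrightarrow> \<pi> (- i) = - \<pi> i"
  by (simp add: WD6_def)

lemma WD6_permutes: "\<pi> \<in> WD6 \<Longrightarrow> \<pi> permutes Idx"
  by (simp add: WD6_def)

lemma WD6_in_Idx: "\<pi> \<in> WD6 \<Longrightarrow> \<pi> i \<in> Idx \<longleftrightarrow> i \<in> Idx"
  by (rule permutes_in_image[OF WD6_permutes])

lemma WD6_eq_iff: "\<pi> \<in> WD6 \<Longrightarrow> \<pi> i = \<pi> j \<longleftrightarrow> i = j"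
  using permutes_inj[OF WD6_permutes] by (auto dest: injD)

lemma WD6_inj_on: "\<pi> \<in> WD6 \<Longrightarrow> inj_on \<pi> A"
  by (simp add: inj_on_def WD6_eq_iff)

lemma WD6_eqI:
  assumes "\<pi> \<in> WD6" "\<pi>' \<in> WD6" "\<And>i. i \<in> Idx \<Longrightarrow> \<pi> i = \<pi>' i"
  shows "\<pi> = \<pi>'"
proof
  fix i
  show "\<pi> i = \<pi>' i"
    using assms(3) permutes_not_in[OF WD6_permutes[OF assms(1)]] permutes_not_in[OF WD6_permutes[OF assms(2)]]
    by (cases "i \<in> Idx") simp_all
qed

lemma WD6_bij_abs:
  assumes "\<pi> \<in> WD6"
  shows "bij_betw (\<lambda>i. \<bar>\<pi> i\<bar>) {1..6} {1..6}"
proof -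
  have "inj_on (\<lambda>i. \<bar>\<pi> i\<bar>) {1..6}"
  proof (rule inj_onI)
    fix i j :: int assume ij: "i \<in> {1..6}" "j \<in> {1..6}" "\<bar>\<pi> i\<bar> = \<bar>\<pi> j\<bar>"
    then have "\<pi> i = \<pi> j \<or> \<pi> i = \<pi> (- j)" using WD6_minus[OF assms] by (auto simp: abs_eq_iff)
    then show "i = j" using ij WD6_eq_iff[OF assms] by auto
  qed
  moreover have "\<bar>\<pi> i\<bar> \<in> {1..6}" if "i \<in> {1..6}" for i
  proof -
    have "i \<in> Idx" using that by (auto simp: Idx_def)
    then show ?thesis using WD6_in_Idx[OF assms, of i] abs_in_iff[of "\<pi> i"] by simp
  qed
  ultimately show ?thesis
    by (simp add: bij_betw_def endo_inj_surj image_subset_iff)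
qed

lemma id_in_WD6: "id \<in> WD6"
proof -
  have "(\<Prod>i::int = 1..6. sgn i) = 1" by (intro prod.neutral) auto
  then show ?thesis by (simp add: WD6_def permutes_id)
qed

lemma WD6_comp:
  assumes "\<sigma> \<in> WD6" "\<pi> \<in> WD6"
  shows "\<sigma> \<circ> \<pi> \<in> WD6"
proof -
  have "sgn (\<sigma> (\<pi> i)) = sgn (\<pi> i) * sgn (\<sigma> \<bar>\<pi> i\<bar>)" if "i \<in> {1..6}" for i
  proof -
    have "\<pi> i \<in> Idx" using that WD6_in_Idx[OF assms(2)] by (auto simp: Idx_def)
    then consider "\<pi> i > 0" | "\<pi> i < 0" by (auto simp: Idx_def) linarith
    then show ?thesis by cases (simp_all add: WD6_minus[OF assms(1)] sgn_minus)
  qed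
  then have "(\<Prod>i = 1..6. sgn (\<sigma> (\<pi> i))) = (\<Prod>i = 1..6. sgn (\<pi> i)) * (\<Prod>i = 1..6. sgn (\<sigma> \<bar>\<pi> i\<bar>))"
    by (simp add: prod.distrib)
  also have "(\<Prod>i = 1..6. sgn (\<sigma> \<bar>\<pi> i\<bar>)) = (\<Prod>i = 1..6. sgn (\<sigma> i))"
    by (rule prod.reindex_bij_betw[OF WD6_bij_abs[OF assms(2)]])
  finally have "(\<Prod>i = 1..6. sgn (\<sigma> (\<pi> i))) = 1" using assms by (simp add: WD6_def)
  then show ?thesis
    using assms permutes_compose[of \<pi> Idx \<sigma>] by (simp add: WD6_def)
qed

lemma WD6_signed_perm:
  assumes "\<pi> \<in> WD6" "\<pi> ` {1..k} = {1..k}" "\<And>i. k < i \<Longrightarrow> \<pi> i = i"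
  shows "\<exists>\<sigma>. \<sigma> permutes {1..k} \<and> signed \<sigma> = \<pi>"
proof (intro exI conjI)
  let ?\<sigma> = "\<lambda>i. if i \<in> {1..k} then \<pi> i else i"
  have "bij_betw ?\<sigma> {1..k} {1..k}"
    using WD6_inj_on[OF assms(1), of "{1..k}"] assms(2)
    by (subst bij_betw_cong[of _ _ \<pi>]) (auto simp: bij_betw_def)
  then show "?\<sigma> permutes {1..k}" by (rule bij_imp_permutes) auto
  show "signed ?\<sigma> = \<pi>"
    by (rule odd_eqI) (auto simp: signed_minus signed_pos WD6_minus[OF assms(1)] assms(3))
qed

lemma prod_sgn:
  fixes f :: "'a \<Rightarrow> int"
  assumes "finite A" "\<And>i. i \<in> A \<Longrightarrow> f i \<noteq> 0"
  shows "(\<Prod>i\<in>A. sgn (f i)) = (- 1) ^ card {i \<in> A. f i < 0}"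
proof -
  have "(\<Prod>i\<in>A. sgn (f i)) = (\<Prod>i\<in>A. if f i < 0 then - 1 else 1)"
    using assms(2) by (intro prod.cong) (auto simp: sgn_if)
  also have "\<dots> = (- 1) ^ card {i \<in> A. f i < 0}"
    using assms(1) by (simp flip: prod.inter_filter)
  finally show ?thesis .
qed

lemma even_card_negatives:
  assumes "\<pi> \<in> WD6"
  shows "even (card {i \<in> {1..6}. \<pi> i < 0})"
proof -
  have "\<pi> i \<noteq> 0" if "i \<in> {1..6}" for i
    using that WD6_in_Idx[OF assms, of i] by (auto simp: Idx_def)
  then have "(- 1) ^ card {i \<in> {1..6}. \<pi> i < 0} = (1::int)"
    using prod_sgn[of "{1..6}" \<pi>] assms by (simp add: WD6_def)
  then show ?thesis by (cases "even (card {i \<in> {1..6}. \<pi> i < 0})") simp_all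
qed

definition negate :: "int set \<Rightarrow> int \<Rightarrow> int"
  where "negate E k = (if k \<in> E then - k else k)"

lemma signed_negate_in_WD6:
  assumes "E \<subseteq> {1..6}" "even (card E)"
  shows "signed (negate E) \<in> WD6"
proof (rule signed_in_WD6)
  have "\<bar>negate E k\<bar> = k" if "k \<in> {1..6}" for k using that by (auto simp: negate_def)
  then show "(\<lambda>k. \<bar>negate E k\<bar>) ` {1..6} = {1..6}" by force
  show "negate E k = k" if "k > 6" for k using that assms by (auto simp: negate_def)
  have "{i \<in> {1..6}. negate E i < 0} = E" using assms by (auto simp: negate_def)
  then show "(\<Prod>i = 1..6. sgn (negate E i)) = 1"
    using assms by (subst prod_sgn) (auto simp: negate_def)
qed

lemma ex_permutes_two:
  assumes "p \<in> A" "q \<in> A" "i \<in> A" "j \<in> A" "p \<noteq> q" "i \<noteq> j"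
  shows "\<exists>g. g permutes A \<and> g p = i \<and> g q = j"
proof -
  define g where "g = Transposition.transpose (Transposition.transpose p i q) j \<circ> Transposition.transpose p i"
  have "Transposition.transpose p i q \<in> A" using assms by (auto simp: Transposition.transpose_def)
  then have "g permutes A"
    unfolding g_def using assms by (intro permutes_compose permutes_swap_id)
  moreover have "g p = i" "g q = j" using assms by (auto simp: g_def Transposition.transpose_def)
  ultimately show ?thesis by blast
qed

context
  fixes H :: "(int \<Rightarrow> int) set" and k :: int
  assumes id_H: "id \<in> H" and comp_H: "\<And>f g. f \<in> H \<Longrightarrow> g \<in> H \<Longrightarrow> f \<circ> g \<in> H"
    and adj_H: "\<And>a. 1 \<le> a \<Longrightarrow> a < k \<Longrightarrow> signed (Transposition.transpose a (a + 1)) \<in> H"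
begin

lemma signed_transpose_generated:
  assumes "1 \<le> a" "a < b" "b \<le> k"
  shows "signed (Transposition.transpose a b) \<in> H"
  using assms(2,3)
proof (induction b rule: int_gr_induct)
  case base
  then show ?case using adj_H assms(1) by simp
next
  case (step b)
  have *: "Transposition.transpose a (b + 1)
      = Transposition.transpose b (b + 1) \<circ> (Transposition.transpose a b \<circ> Transposition.transpose b (b + 1))"
    using step.hyps by (auto simp: fun_eq_iff Transposition.transpose_def)
  have pos: "Transposition.transpose c d i > 0" if "c > 0" "d > 0" "i > 0" for c d i :: int
    using that by (simp add: Transposition.transpose_def)
  have "signed (Transposition.transpose a (b + 1)) = signed (Transposition.transpose b (b + 1)) \<circ>
      (signed (Transposition.transpose a b) \<circ> signed (Transposition.transpose b (b + 1)))"
    unfolding * using assms(1) step.hyps by (subst signed_comp, simp add: pos, subst signed_comp) (simp_all add: pos)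
  moreover have "signed (Transposition.transpose b (b + 1)) \<in> H"
    using step assms(1) by (intro adj_H) auto
  ultimately show ?case
    using step.IH step.prems by (simp only:) (intro comp_H, simp_all)
qed

lemma signed_perm_generated:
  assumes "\<sigma> permutes {1..k}"
  shows "signed \<sigma> \<in> H"
  using assms finite_atLeastAtMost_int
proof (induction rule: permutes_induct)
  case id
  have "signed id = id" by (rule odd_eqI) (auto simp: signed_minus signed_pos)
  then show ?case using id_H by metis
next
  case (swap a b p)
  have "p i > 0" if "i > 0" for i
    using permutes_in_image[OF \<open>p permutes {1..k}\<close>, of i] permutes_not_in[OF \<open>p permutes {1..k}\<close>, of i] that
    by (cases "i \<in> {1..k}") auto
  then have "signed (Transposition.transpose a b \<circ> p) = signed (Transposition.transpose a b) \<circ> signed p"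
    by (rule signed_comp)
  moreover have "signed (Transposition.transpose a b) \<in> H"
    using signed_transpose_generated[of a b] signed_transpose_generated[of b a] swap(1-3)
    by (cases "a < b") (auto simp: transpose_commute)
  ultimately show ?case using comp_H swap.IH by (simp only:)
qed

lemma signed_negate_generated:
  assumes flip: "signed flip12 \<in> H" and ij: "i \<in> {1..k}" "j \<in> {1..k}" "i \<noteq> j"
  shows "signed (negate {i, j}) \<in> H"
proof -
  have "k \<ge> 2" using ij by auto
  then obtain g where g: "g permutes {1..k}" "g 1 = i" "g 2 = j"
    using ex_permutes_two[of 1 "{1..k}" 2 i j] ij by auto
  have g': "inv_into UNIV g permutes {1..k}" by (rule permutes_inv[OF g(1)])
  have gg: "g (inv_into UNIV g l) = l" for l using permutes_inverses(1)[OF g(1)] .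
  have pos: "inv_into UNIV g l > 0" if "l > 0" for l
    using permutes_in_image[OF g', of l] permutes_not_in[OF g', of l] that
    by (cases "l \<in> {1..k}") auto
  have i: "inv_into UNIV g l = 1 \<longleftrightarrow> l = i" and j: "inv_into UNIV g l = 2 \<longleftrightarrow> l = j" for l
    using g permutes_inverses[OF g(1)] by metis+
  have "signed (negate {i, j}) = signed g \<circ> (signed flip12 \<circ> signed (Transposition.transpose 1 2)) \<circ> signed (inv_into UNIV g)"
  proof (rule odd_eqI)
    fix l :: int assume l: "l > 0"
    define m where "m = inv_into UNIV g l"
    have m: "m > 0" "g m = l" using pos[OF l] gg by (simp_all add: m_def)
    have "(signed flip12 \<circ> signed (Transposition.transpose 1 2)) m = (if m = 1 \<or> m = 2 then - m else m)"
      using m(1) by (auto simp: signed_pos flip12_def Transposition.transpose_def)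
    moreover have "m = 1 \<or> m = 2 \<longleftrightarrow> l = i \<or> l = j"
      using i j by (simp add: m_def)
    moreover have "signed (inv_into UNIV g) l = m" using l by (simp add: signed_pos m_def)
    moreover have "signed g m = l" "signed g (- m) = - l"
      using m by (simp_all add: signed_minus signed_pos)
    ultimately show "signed (negate {i, j}) l
      = (signed g \<circ> (signed flip12 \<circ> signed (Transposition.transpose 1 2)) \<circ> signed (inv_into UNIV g)) l"
      using l by (simp add: signed_pos negate_def)
  qed (simp_all add: signed_minus)
  moreover have "signed (Transposition.transpose 1 2) \<in> H"
    using signed_transpose_generated[of 1 2] \<open>k \<ge> 2\<close> by simp
  ultimately show ?thesis
    using signed_perm_generated[OF g(1)] signed_perm_generated[OF g'] flip
    by (simp only:) (intro comp_H)
qed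

lemma WD6_generated:
  assumes flip: "signed flip12 \<in> H" and k: "1 \<le> k" "k \<le> 6"
    and "\<pi> \<in> WD6" "\<And>i. k < i \<Longrightarrow> \<pi> i = i"
  shows "\<pi> \<in> H"
  using assms(4,5)
proof (induction "card {i \<in> {1..6}. \<pi> i < 0}" arbitrary: \<pi> rule: less_induct)
  case less
  define N where "N = {i \<in> {1..6}. \<pi> i < 0}"
  have fin: "finite N" by (rule finite_subset[of _ "{1..6}"]) (auto simp: N_def)
  have Nk: "N \<subseteq> {1..k}"
  proof
    fix i assume "i \<in> N"
    then have "1 \<le> i" "\<pi> i \<noteq> i" by (auto simp: N_def)
    then show "i \<in> {1..k}" using less.prems(2)[of i] by force
  qed
  show ?case
  proof (cases "N = {}")
    case True
    have "\<pi> i \<in> {1..k}" if "i \<in> {1..k}" for i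
    proof -
      have "\<pi> i \<in> Idx" using that k WD6_in_Idx[OF less.prems(1)] by (auto simp: Idx_def)
      moreover have "\<not> \<pi> i < 0" using that k True by (auto simp: N_def)
      moreover have "\<pi> i \<le> k"
      proof (rule ccontr)
        assume "\<not> \<pi> i \<le> k"
        then have "\<pi> (\<pi> i) = \<pi> i" using less.prems(2) by simp
        then show False using \<open>\<not> \<pi> i \<le> k\<close> that WD6_eq_iff[OF less.prems(1)] by simp
      qed
      ultimately show ?thesis by (auto simp: Idx_def)
    qed
    then have "\<pi> ` {1..k} = {1..k}"
      by (intro endo_inj_surj WD6_inj_on[OF less.prems(1)]) auto
    then obtain \<sigma> where "\<sigma> permutes {1..k}" "signed \<sigma> = \<pi>"
      using WD6_signed_perm[OF less.prems(1)] less.prems(2) by blast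
    then show ?thesis using signed_perm_generated[of \<sigma>] by simp
  next
    case False
    have "even (card N)" using even_card_negatives[OF less.prems(1)] by (simp add: N_def)
    moreover have "card N \<noteq> 0" using False fin by simp
    ultimately have "2 \<le> card N" by presburger
    then obtain T where "T \<subseteq> N" "card T = 2" by (rule obtain_subset_with_card_n)
    then obtain i j where ij: "i \<in> N" "j \<in> N" "i \<noteq> j"
      by (auto simp: card_2_iff)
    define \<nu> where "\<nu> = signed (negate {i, j})"
    have neg: "\<nu> \<in> WD6"
      unfolding \<nu>_def using ij by (intro signed_negate_in_WD6) (auto simp: N_def)
    have \<nu>_pos: "\<nu> l = (if l = i \<or> l = j then - l else l)" if "l > 0" for l
      using that by (simp add: \<nu>_def signed_pos negate_def)
    have "\<nu> \<circ> \<nu> = id"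
      by (rule odd_eqI) (auto simp: \<nu>_def signed_minus signed_pos negate_def)
    then have eq: "\<pi> = (\<pi> \<circ> \<nu>) \<circ> \<nu>" by (simp add: comp_assoc)
    have "{l \<in> {1..6}. (\<pi> \<circ> \<nu>) l < 0} = N - {i, j}"
      using ij by (auto simp: N_def \<nu>_pos WD6_minus[OF less.prems(1)] split: if_splits)
    then have "card {l \<in> {1..6}. (\<pi> \<circ> \<nu>) l < 0} < card N"
      using psubset_card_mono[OF fin, of "N - {i, j}"] ij by auto
    then have "\<pi> \<circ> \<nu> \<in> H"
      unfolding N_def
    proof (rule less.hyps)
      show "\<pi> \<circ> \<nu> \<in> WD6" by (rule WD6_comp[OF less.prems(1) neg])
      show "(\<pi> \<circ> \<nu>) l = l" if "k < l" for l
      proof -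
        have "l \<noteq> i" "l \<noteq> j" "l > 0" using ij Nk that k by auto
        then show ?thesis using \<nu>_pos less.prems(2)[OF that] by simp
      qed
    qed
    moreover have "\<nu> \<in> H"
      unfolding \<nu>_def using ij Nk flip by (intro signed_negate_generated) auto
    ultimately have "(\<pi> \<circ> \<nu>) \<circ> \<nu> \<in> H" by (rule comp_H)
    then show ?thesis by (simp only: eq[symmetric])
  qed
qed

end

section \<open>Half-spin weights and pairs of signed indices\<close>

text \<open>These are the weights of a half-spin representation, each given by its set of positive axes.\<close>

definition spins :: "int set set"
  where "spins = (\<lambda>\<pi>. \<pi> ` {1..6}) ` WD6"

definition act :: "(int \<Rightarrow> int) \<Rightarrow> int set \<times> int set \<Rightarrow> int set \<times> int set"
  where "act \<pi> z = (\<pi> ` fst z, \<pi> ` snd z)"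

lemma spinsE:
  assumes "T \<in> spins"
  obtains \<pi> where "\<pi> \<in> WD6" "T = \<pi> ` {1..6}"
  using assms by (auto simp: spins_def)

lemma WD6_spins: "\<pi> \<in> WD6 \<Longrightarrow> \<pi> ` {1..6} \<in> spins"
  by (auto simp: spins_def)

lemma WD6_image_spins:
  assumes "\<pi> \<in> WD6" "T \<in> spins"
  shows "\<pi> ` T \<in> spins"
proof -
  obtain \<sigma> where "\<sigma> \<in> WD6" "T = \<sigma> ` {1..6}" using assms(2) by (rule spinsE)
  then show ?thesis using WD6_spins[OF WD6_comp[OF assms(1), of \<sigma>]] by (simp only: image_comp)
qed

lemma spin_subset: "T \<in> spins \<Longrightarrow> T \<subseteq> Idx"
  by (auto elim!: spinsE simp: WD6_in_Idx) (auto simp: Idx_def)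

lemma spin_finite: "T \<in> spins \<Longrightarrow> finite T"
  by (auto elim!: spinsE)

lemma spin_card: "T \<in> spins \<Longrightarrow> card T = 6"
  by (auto elim!: spinsE simp: card_image WD6_inj_on)

lemma spin_minus:
  assumes "T \<in> spins" "i \<in> Idx"
  shows "- i \<in> T \<longleftrightarrow> i \<notin> T"
proof -
  obtain \<pi> where \<pi>: "\<pi> \<in> WD6" "T = \<pi> ` {1..6}" using assms(1) by (rule spinsE)
  obtain j where j: "i = \<pi> j" "j \<in> Idx"
    using permutes_image[OF WD6_permutes[OF \<pi>(1)]] assms(2) by blast
  have mem: "\<pi> l \<in> T \<longleftrightarrow> l \<in> {1..6}" for l
    unfolding \<pi>(2) by (simp only: image_iff WD6_eq_iff[OF \<pi>(1)]) blast
  show ?thesis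
    unfolding j(1) WD6_minus[OF \<pi>(1), symmetric] mem using j(2) by (auto simp: Idx_def)
qed

lemma spin_ex:
  assumes "T \<in> spins" "i \<in> T" "j \<in> T" "i \<noteq> j" "p \<in> {1..6}" "q \<in> {1..6}" "p \<noteq> q"
  shows "\<exists>\<pi>\<in>WD6. \<pi> ` {1..6} = T \<and> \<pi> p = i \<and> \<pi> q = j"
proof -
  obtain \<pi> where \<pi>: "\<pi> \<in> WD6" "T = \<pi> ` {1..6}" using assms(1) by (rule spinsE)
  obtain i' j' where ij: "i = \<pi> i'" "j = \<pi> j'" "i' \<in> {1..6}" "j' \<in> {1..6}"
    using assms(2,3) \<pi>(2) by blast
  then obtain g where g: "g permutes {1..6}" "g p = i'" "g q = j'"
    using ex_permutes_two[of p "{1..6}" q i' j'] assms by auto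
  have "signed g ` {1..6} = g ` {1..6}" by (intro image_cong) (auto simp: signed_pos)
  then have "(\<pi> \<circ> signed g) ` {1..6} = T"
    using permutes_image[OF g(1)] \<pi>(2) by (simp only: image_comp[symmetric])
  moreover have "(\<pi> \<circ> signed g) p = i" "(\<pi> \<circ> signed g) q = j"
    using assms(5,6) g ij by (auto simp: signed_pos)
  moreover have "\<pi> \<circ> signed g \<in> WD6"
    using WD6_comp \<pi>(1) signed_perm_in_WD6 g(1) by blast
  ultimately show ?thesis by blast
qed

lemma negate_image: "E \<subseteq> {1..6} \<Longrightarrow> negate E ` {1..6} \<inter> {1..6} = {1..6} - E"
  by (auto simp: negate_def)

lemma spins_eq: "spins = (\<lambda>E. negate E ` {1..6}) ` {E. E \<subseteq> {1..6} \<and> even (card E)}"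
proof
  show "(\<lambda>E. negate E ` {1..6}) ` {E. E \<subseteq> {1..6} \<and> even (card E)} \<subseteq> spins"
  proof clarify
    fix E :: "int set" assume E: "E \<subseteq> {1..6}" "even (card E)"
    have "negate E ` {1..6} = signed (negate E) ` {1..6}"
      by (intro image_cong) (auto simp: signed_pos)
    then show "negate E ` {1..6} \<in> spins"
      using WD6_spins[OF signed_negate_in_WD6[OF E]] by simp
  qed
  show "spins \<subseteq> (\<lambda>E. negate E ` {1..6}) ` {E. E \<subseteq> {1..6} \<and> even (card E)}"
  proof
    fix T assume T: "T \<in> spins"
    then obtain \<pi> where \<pi>: "\<pi> \<in> WD6" "T = \<pi> ` {1..6}" by (rule spinsE)
    define E where "E = uminus ` \<pi> ` {i \<in> {1..6}. \<pi> i < 0}"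
    have mem: "j \<in> E \<longleftrightarrow> j > 0 \<and> - j \<in> T" for j
      unfolding E_def \<pi>(2) by (force simp: image_iff)
    have "E \<subseteq> {1..6}"
      using spin_subset[OF T] by (auto simp: mem Idx_def)
    moreover have "card E = card {i \<in> {1..6}. \<pi> i < 0}"
      unfolding E_def by (simp add: card_image WD6_inj_on[OF \<pi>(1)])
    moreover have "T = negate E ` {1..6}"
    proof (rule sym, rule card_subset_eq)
      have "negate E j \<in> T" if "j \<in> {1..6}" for j
        using that spin_minus[OF T, of j] by (auto simp: negate_def mem Idx_def)
      then show "negate E ` {1..6} \<subseteq> T" by blast
      have "inj_on (negate E) {1..6}" by (auto simp: inj_on_def negate_def)
      then show "card (negate E ` {1..6}) = card T" by (simp add: card_image spin_card[OF T])
    qed (rule spin_finite[OF T])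
    ultimately show "T \<in> (\<lambda>E. negate E ` {1..6}) ` {E. E \<subseteq> {1..6} \<and> even (card E)}"
      using even_card_negatives[OF \<pi>(1)] by auto
  qed
qed

lemma card_spins: "card spins = 32"
proof -
  let ?ev = "{E::int set. E \<subseteq> {1..6} \<and> even (card E)}" and ?od = "{E::int set. E \<subseteq> {1..6} \<and> odd (card E)}"
  have "inj_on (\<lambda>E. negate E ` {1..6}) ?ev"
  proof (rule inj_onI)
    fix E F assume "E \<in> ?ev" "F \<in> ?ev" "negate E ` {1..6} = negate F ` {1..6}"
    then have "{1..6} - E = {1..6} - F" "E \<subseteq> {1..6}" "F \<subseteq> {1..6}"
      using negate_image[of E] negate_image[of F] by auto
    then show "E = F" by blast
  qed
  then have "card spins = card ?ev" unfolding spins_eq by (rule card_image)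
  moreover have "card ?ev = card ?od"
    using card_subsupersets_even_odd[of "{1..6::int}" "{}"] by (simp add: psubset_eq)
  moreover have "card ?ev + card ?od = card (Pow {1..6::int})"
  proof (subst card_Un_disjoint[symmetric])
    show "card (?ev \<union> ?od) = card (Pow {1..6::int})" by (rule arg_cong[of _ _ card]) auto
  qed auto
  ultimately show ?thesis by (simp add: card_Pow)
qed

definition orb :: "int set \<times> int set \<Rightarrow> (int set \<times> int set) set"
  where "orb z = (\<lambda>\<pi>. act \<pi> z) ` WD6"

lemma positive_spin: "{1..6::int} \<in> spins" 
  using WD6_spins[OF id_in_WD6] by simp

lemma orb_in_Sigma:
  assumes "\<And>\<pi>. \<pi> \<in> WD6 \<Longrightarrow> \<pi> ` X \<in> F (\<pi> ` {1..6})"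
    and "\<And>T Z. T \<in> spins \<Longrightarrow> Z \<in> F T \<Longrightarrow> \<exists>\<pi>\<in>WD6. \<pi> ` {1..6} = T \<and> \<pi> ` X = Z"
  shows "orb ({1..6}, X) = Sigma spins F"
proof
  show "orb ({1..6}, X) \<subseteq> Sigma spins F"
    using assms(1) WD6_spins by (auto simp: orb_def act_def)
  show "Sigma spins F \<subseteq> orb ({1..6}, X)"
  proof clarify
    fix T Z assume "T \<in> spins" "Z \<in> F T"
    then obtain \<pi> where "\<pi> \<in> WD6" "\<pi> ` {1..6} = T" "\<pi> ` X = Z" using assms(2) by blast
    then show "(T, Z) \<in> orb ({1..6}, X)"
      unfolding orb_def act_def by (intro image_eqI[of _ _ \<pi>]) simp_all
  qed
qed

lemma orb_65: "orb ({1..6}, {6, 5}) = Sigma spins (\<lambda>T. {X. X \<subseteq> T \<and> card X = 2})"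
proof (rule orb_in_Sigma)
  fix T Z assume T: "T \<in> spins" and "Z \<in> {X. X \<subseteq> T \<and> card X = 2}"
  then obtain i j where ij: "Z = {i, j}" "i \<noteq> j" "i \<in> T" "j \<in> T" by (auto simp: card_2_iff)
  then show "\<exists>\<pi>\<in>WD6. \<pi> ` {1..6} = T \<and> \<pi> ` {6, 5} = Z"
    using spin_ex[OF T, of i j 6 5] by auto
qed (auto simp: WD6_eq_iff)

lemma orb_bar12:
  "orb ({1..6}, {- 1, - 2}) = Sigma spins (\<lambda>T. {X. X \<subseteq> uminus ` T \<and> card X = 2})"
proof (rule orb_in_Sigma)
  fix T Z assume T: "T \<in> spins" and "Z \<in> {X. X \<subseteq> uminus ` T \<and> card X = 2}"
  then obtain i j where ij: "Z = {- i, - j}" "i \<noteq> j" "i \<in> T" "j \<in> T" by (auto simp: card_2_iff)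
  then show "\<exists>\<pi>\<in>WD6. \<pi> ` {1..6} = T \<and> \<pi> ` {- 1, - 2} = Z"
    using spin_ex[OF T, of i j 1 2] by (auto simp: WD6_minus)
qed (auto simp: WD6_eq_iff WD6_minus)

lemma orb_6bar6: "orb ({1..6}, {6, - 6}) = Sigma spins (\<lambda>T. (\<lambda>i. {i, - i}) ` T)"
proof (rule orb_in_Sigma)
  fix T Z assume T: "T \<in> spins" and "Z \<in> (\<lambda>i. {i, - i}) ` T"
  then obtain i where i: "Z = {i, - i}" "i \<in> T" by auto
  have "\<exists>j\<in>T. i \<noteq> j"
  proof (rule ccontr)
    assume "\<not> ?thesis"
    then have "T \<subseteq> {i}" by auto
    then have "card T \<le> 1" using card_mono[of "{i}" T] by simp
    then show False using spin_card[OF T] by simp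
  qed
  then obtain j where "j \<in> T" "i \<noteq> j" by blast
  then show "\<exists>\<pi>\<in>WD6. \<pi> ` {1..6} = T \<and> \<pi> ` {6, - 6} = Z"
    using spin_ex[OF T, of i j 6 5] i by (auto simp: WD6_minus)
qed (auto simp: WD6_minus)

lemma orb_bar65: "orb ({1..6}, {- 6, 5}) =
    Sigma spins (\<lambda>T. (\<lambda>(i, j). {- i, j}) ` {(i, j). i \<in> T \<and> j \<in> T \<and> i \<noteq> j})"
proof (rule orb_in_Sigma)
  fix T Z assume T: "T \<in> spins"
    and "Z \<in> (\<lambda>(i, j). {- i, j}) ` {(i, j). i \<in> T \<and> j \<in> T \<and> i \<noteq> j}"
  then obtain i j where ij: "Z = {- i, j}" "i \<noteq> j" "i \<in> T" "j \<in> T" by auto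
  then show "\<exists>\<pi>\<in>WD6. \<pi> ` {1..6} = T \<and> \<pi> ` {- 6, 5} = Z"
    using spin_ex[OF T, of i j 6 5] by (auto simp: WD6_minus)
next
  fix \<pi> assume "\<pi> \<in> WD6"
  then show "\<pi> ` {- 6, 5} \<in> (\<lambda>(i, j). {- i, j}) ` {(i, j). i \<in> \<pi> ` {1..6} \<and> j \<in> \<pi> ` {1..6} \<and> i \<noteq> j}"
    by (intro image_eqI[of _ _ "(\<pi> 6, \<pi> 5)"]) (auto simp: WD6_minus WD6_eq_iff)
qed

lemma card_Sigma_spins:
  assumes "\<And>T. T \<in> spins \<Longrightarrow> card (F T) = n" "n > 0"
  shows "card (Sigma spins F) = 32 * n"
proof -
  have "finite spins" using card_spins card.infinite by fastforce
  moreover have "finite (F T)" if "T \<in> spins" for T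
    using assms that card.infinite by fastforce
  ultimately show ?thesis using assms by (simp add: card_SigmaI card_spins)
qed

lemma card_orb:
  "card (orb ({1..6}, {6, 5})) = 480"
  "card (orb ({1..6}, {- 6, 5})) = 960"
  "card (orb ({1..6}, {6, - 6})) = 192"
  "card (orb ({1..6}, {- 1, - 2})) = 480"
proof -
  have choose: "6 choose 2 = (15::nat)" by (simp add: choose_two)
  have "card {X. X \<subseteq> T \<and> card X = 2} = 15" if "T \<in> spins" for T
    using that by (simp add: n_subsets spin_finite spin_card choose)
  from card_Sigma_spins[OF this] show "card (orb ({1..6}, {6, 5})) = 480"
    by (simp add: orb_65)
  have "card {X. X \<subseteq> uminus ` T \<and> card X = 2} = 15" if "T \<in> spins" for T
    using that by (simp add: n_subsets spin_finite spin_card choose card_image)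
  from card_Sigma_spins[OF this] show "card (orb ({1..6}, {- 1, - 2})) = 480"
    by (simp add: orb_bar12)
  have "card ((\<lambda>i. {i, - i}) ` T) = 6" if T: "T \<in> spins" for T
  proof (subst card_image)
    show "inj_on (\<lambda>i. {i, - i}) T"
      using spin_minus[OF T] spin_subset[OF T] by (auto simp: inj_on_def doubleton_eq_iff)
  qed (rule spin_card[OF T])
  from card_Sigma_spins[OF this] show "card (orb ({1..6}, {6, - 6})) = 192"
    by (simp add: orb_6bar6)
  have "card ((\<lambda>(i, j). {- i, j}) ` {(i, j). i \<in> T \<and> j \<in> T \<and> i \<noteq> j}) = 30" if T: "T \<in> spins" for T
  proof (subst card_image)
    show "inj_on (\<lambda>(i, j). {- i, j}) {(i, j). i \<in> T \<and> j \<in> T \<and> i \<noteq> j}"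
      using spin_minus[OF T] spin_subset[OF T] by (auto simp: inj_on_def doubleton_eq_iff)
    have "{(i, j). i \<in> T \<and> j \<in> T \<and> i \<noteq> j} = (SIGMA i:T. T - {i})" by auto
    then show "card {(i, j). i \<in> T \<and> j \<in> T \<and> i \<noteq> j} = 30"
      using T by (simp add: card_SigmaI spin_finite spin_card)
  qed
  from card_Sigma_spins[OF this] show "card (orb ({1..6}, {- 6, 5})) = 960"
    by (simp add: orb_bar65)
qed

lemma orbs_cover:
  assumes T: "T \<in> spins" and X: "X \<subseteq> Idx" "card X = 2"
  shows "(T, X) \<in> orb ({1..6}, {6, 5}) \<union> orb ({1..6}, {- 6, 5}) \<union>
                 orb ({1..6}, {6, - 6}) \<union> orb ({1..6}, {- 1, - 2})"
proof -
  obtain i j where ij: "X = {i, j}" "i \<noteq> j" "i \<in> Idx" "j \<in> Idx" using X by (auto simp: card_2_iff)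
  have neg: "l \<in> uminus ` T" if "l \<in> Idx" "l \<notin> T" for l
    using spin_minus[OF T that(1)] that(2) by (auto intro!: image_eqI[of _ _ "- l"])
  have mixed: "(T, {k, l}) \<in> orb ({1..6}, {- 6, 5}) \<union> orb ({1..6}, {6, - 6})"
    if "k \<in> Idx" "k \<notin> T" "l \<in> T" for k l
  proof (cases "k = - l")
    case True
    then show ?thesis using T that by (auto simp: orb_6bar6)
  next
    case False
    moreover have "- k \<in> T" using spin_minus[OF T that(1)] that(2) by simp
    ultimately show ?thesis
      using T that by (auto simp: orb_bar65 intro!: image_eqI[of _ _ "(- k, l)"])
  qed
  consider "i \<in> T" "j \<in> T" | "i \<in> T" "j \<notin> T" | "i \<notin> T" "j \<in> T" | "i \<notin> T" "j \<notin> T" by blast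
  then show ?thesis
  proof cases
    case 1
    then show ?thesis using T X ij by (simp add: orb_65)
  next
    case 2
    then show ?thesis using mixed[of j i] ij by (auto simp: insert_commute)
  next
    case 3
    then show ?thesis using mixed[of i j] ij by auto
  next
    case 4
    then show ?thesis using T X ij neg by (simp add: orb_bar12)
  qed
qed

section \<open>Coordinates adapted to the group\<close>

lemma exhaust_7: fixes x :: 7
  shows "x = 1 \<or> x = 2 \<or> x = 3 \<or> x = 4 \<or> x = 5 \<or> x = 6 \<or> x = 7"
proof (induct x)
  case (of_int z)
  then have "0 \<le> z" and "z < 7" by simp_all
  then have "z = 0 \<or> z = 1 \<or> z = 2 \<or> z = 3 \<or> z = 4 \<or> z = 5 \<or> z = 6" by arith
  then show ?case by auto
qed

lemma forall_7: "(\<forall>i::7. P i) \<longleftrightarrow> P 1 \<and> P 2 \<and> P 3 \<and> P 4 \<and> P 5 \<and> P 6 \<and> P 7"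
  by (metis exhaust_7)

lemma swap_matrix_mult: "swap_matrix i j *v x = (\<chi> k. x $ Transposition.transpose i j k)"
proof -
  have *: "k = Transposition.transpose i j l \<longleftrightarrow> l = Transposition.transpose i j k" for k l
    by (metis transpose_involutory)
  have "(\<Sum>l\<in>UNIV. (if k = Transposition.transpose i j l then 1 else 0) * x $ l)
        = (\<Sum>l\<in>UNIV. if l = Transposition.transpose i j k then x $ l else 0)" for k
    by (intro sum.cong refl) (auto simp: *)
  then show ?thesis
    by (simp add: vec_eq_iff swap_matrix_def perm_matrix_def matrix_vector_mult_def sum.delta)
qed

lemma A0_mult: "A0 *v x = on_coords (\<lambda>a b c d e f g.
    vector [a, b, g - c, g - d, e + g - c - d, f + g - c - d, g]) x"
proof -
  have "Vector_Spaces.linear (*s) (*s) (on_coords (\<lambda>a b c d e f g.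
    vector [a, b, g - c, g - d, e + g - c - d, f + g - c - d, g] :: vec7))"
    by unfold_locales (simp_all add: vec_eq_iff forall_7 on_coords_def vector_7 algebra_simps)
  then show ?thesis
    unfolding A0_def by (rule matrix_works)
qed

definition level_form :: "vec7 \<Rightarrow> complex"
  where "level_form = on_coords (\<lambda>a b c d e f g. e + f + g - a - b - c - d)"

text \<open>
  The linear forms \<open>axis_form i\<close>, together with \<^term>\<open>level_form\<close>, are coordinates in which
  the generators of \<^const>\<open>M\<close> act by signed permutations. The form \<open>axis_form 6\<close> spans, modulo \<^term>\<open>level_form\<close>, the
  \<^const>\<open>G_L\<close>-invariant forms, and \<open>axis_form i\<close> is its translate by the label \<open>i\<close>; the label
  \<open>i\<close> with a bar gives \<open>- axis_form i\<close>.
\<close>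

definition axis_form :: "int \<Rightarrow> vec7 \<Rightarrow> complex" where
  "axis_form i = on_coords (\<lambda>a b c d e f g. of_int (sgn i) *
     (if \<bar>i\<bar> = 1 then b + c - a - d else if \<bar>i\<bar> = 2 then b + d - a - c else
      if \<bar>i\<bar> = 3 then c + d - a - b else if \<bar>i\<bar> = 4 then 2 * g - a - b - c - d else
      if \<bar>i\<bar> = 5 then 2 * f - a - b - c - d else if \<bar>i\<bar> = 6 then 2 * e - a - b - c - d else 0))"

text \<open>
  Since \<open>m\<close> acts on forms by precomposition, a product of matrices corresponds to the composition
  of the index maps in the reverse order.
\<close>

definition acts_by :: "mat7 \<Rightarrow> (int \<Rightarrow> int) \<Rightarrow> bool" where
  "acts_by m \<pi> \<longleftrightarrow> (\<forall>x. level_form (m *v x) = level_form x \<and> (\<forall>i. axis_form i (m *v x) = axis_form (\<pi> i) x))"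

lemma axis_form_uminus: "axis_form (- i) x = - axis_form i x"
  by (simp add: axis_form_def on_coords_def)

lemma acts_by_signedI:
  assumes "\<And>x. level_form (m *v x) = level_form x" "\<And>i x. i > 0 \<Longrightarrow> axis_form i (m *v x) = axis_form (f i) x"
  shows "acts_by m (signed f)"
proof -
  have "axis_form i (m *v x) = axis_form (signed f i) x" for i x
  proof (cases i "0::int" rule: linorder_cases)
    case less
    then show ?thesis using assms(2)[of "- i" x]
      by (simp add: signed_def axis_form_uminus sgn_if) (metis minus_minus)
  next
    case equal then show ?thesis by (simp add: signed_def axis_form_def on_coords_def)
  next
    case greater then show ?thesis using assms(2)[of i] by (simp add: signed_def)
  qed
  then show ?thesis using assms(1) by (simp add: acts_by_def)
qed

lemma acts_by_generators:
  "acts_by (swap_matrix 1 2) (signed flip12)"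
  "acts_by (swap_matrix 3 4) (signed (Transposition.transpose 1 2))"
  "acts_by (swap_matrix 2 3) (signed (Transposition.transpose 2 3))"
  "acts_by A0 (signed (Transposition.transpose 1 2 \<circ> Transposition.transpose 3 4))"
  "acts_by (swap_matrix 6 7) (signed (Transposition.transpose 4 5))"
  "acts_by (swap_matrix 5 6) (signed (Transposition.transpose 5 6))"
  by (rule acts_by_signedI; simp add: swap_matrix_mult A0_mult vector_7 on_coords_def Transposition.transpose_def level_form_def axis_form_def flip12_def)+

lemma coords_from_forms:
  defines "s \<equiv> \<lambda>x. 2 * level_form x - axis_form 4 x - axis_form 5 x - axis_form 6 x"
  shows "x $ 1 = (s x - axis_form 1 x - axis_form 2 x - axis_form 3 x) / 4"
    "x $ 2 = (s x + axis_form 1 x + axis_form 2 x - axis_form 3 x) / 4"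
    "x $ 3 = (s x + axis_form 1 x - axis_form 2 x + axis_form 3 x) / 4"
    "x $ 4 = (s x - axis_form 1 x + axis_form 2 x + axis_form 3 x) / 4"
    "x $ 5 = (s x + axis_form 6 x) / 2"
    "x $ 6 = (s x + axis_form 5 x) / 2"
    "x $ 7 = (s x + axis_form 4 x) / 2"
  by (simp_all add: s_def axis_form_def level_form_def on_coords_def field_simps)

lemma vec7_eqI:
  assumes "level_form x = level_form y" "\<And>i. i \<in> {1..6} \<Longrightarrow> axis_form i x = axis_form i y"
  shows "x = y"
  unfolding vec_eq_iff forall_7 by (simp add: coords_from_forms[of x] coords_from_forms[of y] assms)

text \<open>The point where \<open>axis_form i\<close> takes the value \<open>i\<close>, so that it separates the index maps.\<close>

definition base_point :: vec7
  where "base_point = vector [- 19 / 4, - 13 / 4, - 11 / 4, - 9 / 4, - 7 / 2, - 4, - 9 / 2]"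

lemma axis_form_base_point:
  assumes "i \<in> Idx"
  shows "axis_form i base_point = of_int i"
proof -
  have pos: "axis_form j base_point = of_int j" if "j \<in> {1..6}" for j
  proof -
    have "j = 1 \<or> j = 2 \<or> j = 3 \<or> j = 4 \<or> j = 5 \<or> j = 6" using that by auto
    then show ?thesis by (auto simp: axis_form_def on_coords_def base_point_def vector_7)
  qed
  have "i \<in> {1..6} \<or> - i \<in> {1..6}" using assms by (auto simp: Idx_def)
  then show ?thesis using pos[of i] pos[of "- i"] by (auto simp: axis_form_uminus)
qed

lemma level_form_base_point: "level_form base_point = 1"
  by (simp add: level_form_def base_point_def on_coords_def vector_7)

section \<open>The groups as groups of signed permutations\<close>

interpretation GL7: group GL7 by (rule group_GL7)

lemma GL7_simps: "carrier GL7 = {A. invertible A}" "A \<otimes>\<^bsub>GL7\<^esub> B = A ** B" "\<one>\<^bsub>GL7\<^esub> = mat 1"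
  by (simp_all add: GL7_def)

lemma acts_by_mult:
  assumes "acts_by m \<pi>" "acts_by m' \<pi>'"
  shows "acts_by (m ** m') (\<pi>' \<circ> \<pi>)"
  using assms by (simp add: acts_by_def flip: matrix_vector_mul_assoc)

lemma acts_by_id: "acts_by (mat 1) id"
  by (simp add: acts_by_def)

lemma acts_by_inj:
  assumes "acts_by m \<pi>" "acts_by m' \<pi>"
  shows "m = m'"
  unfolding matrix_eq using assms by (auto simp: acts_by_def intro!: vec7_eqI)

lemma acts_by_unique:
  assumes "\<pi> \<in> WD6" "\<pi>' \<in> WD6" "acts_by m \<pi>" "acts_by m' \<pi>'" "m *v base_point = m' *v base_point"
  shows "\<pi> = \<pi>'"
proof (rule WD6_eqI[OF assms(1,2)])
  fix i assume i: "i \<in> Idx"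
  have "axis_form (\<pi> i) base_point = axis_form (\<pi>' i) base_point"
  proof -
    have "axis_form (\<pi> i) base_point = axis_form i (m *v base_point)" "axis_form (\<pi>' i) base_point = axis_form i (m' *v base_point)"
      using assms(3,4) by (simp_all add: acts_by_def)
    then show ?thesis using assms(5) by simp
  qed
  then show "\<pi> i = \<pi>' i" using i assms(1,2) by (simp add: axis_form_base_point WD6_in_Idx)
qed

lemma acts_by_involution:
  assumes "acts_by m \<pi>" "\<pi> \<circ> \<pi> = id"
  shows "m ** m = mat 1"
  using acts_by_inj[OF acts_by_mult[OF assms(1,1)]] acts_by_id assms(2) by simp

definition realized :: "mat7 set \<Rightarrow> (int \<Rightarrow> int) set"
  where "realized G = {\<pi>. \<exists>m\<in>generate GL7 G. acts_by m \<pi>}"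

lemma realized_id: "id \<in> realized G"
  using acts_by_id generate.one[of GL7 G] by (auto simp: realized_def GL7_simps)

lemma realized_incl: "m \<in> G \<Longrightarrow> acts_by m \<pi> \<Longrightarrow> \<pi> \<in> realized G"
  by (auto simp: realized_def intro: generate.incl)

lemma realized_comp:
  assumes "\<pi> \<in> realized G" "\<sigma> \<in> realized G"
  shows "\<pi> \<circ> \<sigma> \<in> realized G"
proof -
  obtain m n where "m \<in> generate GL7 G" "n \<in> generate GL7 G" "acts_by m \<pi>" "acts_by n \<sigma>"
    using assms by (auto simp: realized_def)
  then show ?thesis
    using acts_by_mult[of n \<sigma> m \<pi>] generate.eng[of n GL7 G m]
    by (auto simp: realized_def GL7_simps)
qed

lemma generate_acts:
  assumes gens: "\<And>g. g \<in> G \<Longrightarrow> \<exists>\<pi>\<in>Q. acts_by g \<pi> \<and> \<pi> \<circ> \<pi> = id"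
    and Q: "id \<in> Q" "\<And>f g. f \<in> Q \<Longrightarrow> g \<in> Q \<Longrightarrow> f \<circ> g \<in> Q"
    and "m \<in> generate GL7 G"
  shows "\<exists>\<pi>\<in>Q. acts_by m \<pi>"
  using assms(4)
proof (induction rule: generate.induct)
  case one
  then show ?case using acts_by_id Q(1) by (auto simp: GL7_simps)
next
  case (incl h)
  then show ?case using gens by blast
next
  case (inv h)
  then obtain \<pi> where \<pi>: "\<pi> \<in> Q" "acts_by h \<pi>" "\<pi> \<circ> \<pi> = id" using gens by blast
  then have "h ** h = mat 1" by (simp add: acts_by_involution)
  then have "inv\<^bsub>GL7\<^esub> h = h"
    by (intro GL7.inv_equality) (auto simp: GL7_simps invertible_def)
  then show ?case using \<pi> by auto
next
  case (eng h1 h2)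
  then obtain \<pi>1 \<pi>2 where "\<pi>1 \<in> Q" "acts_by h1 \<pi>1" "\<pi>2 \<in> Q" "acts_by h2 \<pi>2" by blast
  then show ?case using acts_by_mult[of h1 \<pi>1 h2 \<pi>2] Q(2)[of \<pi>2 \<pi>1] by (auto simp: GL7_simps)
qed

lemma signed_involution:
  "signed flip12 \<circ> signed flip12 = id"
  "signed (Transposition.transpose 1 2 \<circ> Transposition.transpose 3 4) \<circ>
     signed (Transposition.transpose 1 2 \<circ> Transposition.transpose 3 4) = id"
  "signed (Transposition.transpose 1 2) \<circ> signed (Transposition.transpose 1 2) = id"
  "signed (Transposition.transpose 2 3) \<circ> signed (Transposition.transpose 2 3) = id"
  "signed (Transposition.transpose 4 5) \<circ> signed (Transposition.transpose 4 5) = id"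
  "signed (Transposition.transpose 5 6) \<circ> signed (Transposition.transpose 5 6) = id"
  by (rule odd_eqI; auto simp: signed_minus signed_pos flip12_def Transposition.transpose_def)+

lemma generators_permute:
  "Transposition.transpose 1 2 \<circ> Transposition.transpose 3 4 permutes {1..6::int}"
  "Transposition.transpose 1 2 permutes {1..6::int}"
  "Transposition.transpose 2 3 permutes {1..6::int}"
  "Transposition.transpose 4 5 permutes {1..6::int}"
  "Transposition.transpose 5 6 permutes {1..6::int}"
  by (intro permutes_compose permutes_swap_id; simp)+

lemma flip12_in_WD6: "signed flip12 \<in> WD6"
proof -
  have "{1..6} = {1, 2, 3, 4, 5, 6 :: int}" by auto
  then show ?thesis by (intro signed_in_WD6) (auto simp: flip12_def)
qed

lemma signed_image: "\<sigma> permutes {1..6} \<Longrightarrow> signed \<sigma> ` {1..6} = {1..6}"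
  by (subst image_cong[OF refl, of _ _ \<sigma>]) (simp_all add: signed_pos permutes_image)

lemma M_acts: "m \<in> M \<Longrightarrow> \<exists>\<pi>\<in>WD6. acts_by m \<pi>"
  unfolding M_def
proof (erule generate_acts[rotated -1])
  show "\<exists>\<pi>\<in>WD6. acts_by g \<pi> \<and> \<pi> \<circ> \<pi> = id"
    if "g \<in> {swap_matrix 1 2, swap_matrix 2 3, swap_matrix 3 4, swap_matrix 5 6, swap_matrix 6 7, A0}" for g
    using that acts_by_generators signed_involution flip12_in_WD6 generators_permute[THEN signed_perm_in_WD6]
    by (elim insertE emptyE; hypsubst; blast)
qed (auto intro: id_in_WD6 WD6_comp)

lemma G_K_acts: "m \<in> G_K \<Longrightarrow> \<exists>\<pi>\<in>{\<pi> \<in> WD6. \<pi> ` {1..6} = {1..6}}. acts_by m \<pi>"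
  unfolding G_K_def
proof (erule generate_acts[rotated -1])
  show "\<exists>\<pi>\<in>{\<pi> \<in> WD6. \<pi> ` {1..6} = {1..6}}. acts_by g \<pi> \<and> \<pi> \<circ> \<pi> = id"
    if "g \<in> {swap_matrix 2 3, swap_matrix 3 4, swap_matrix 5 6, swap_matrix 6 7, A0}" for g
    using that acts_by_generators signed_involution generators_permute[THEN signed_perm_in_WD6]
      generators_permute[THEN signed_image]
    by (elim insertE emptyE; hypsubst; blast)
next
  fix f g assume "f \<in> {\<pi> \<in> WD6. \<pi> ` {1..6} = {1..6}}" "g \<in> {\<pi> \<in> WD6. \<pi> ` {1..6} = {1..6}}"
  then show "f \<circ> g \<in> {\<pi> \<in> WD6. \<pi> ` {1..6} = {1..6}}"
    by (simp add: WD6_comp image_comp[symmetric] del: comp_apply)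
qed (simp add: id_in_WD6)

lemma G_L_acts: "m \<in> G_L \<Longrightarrow> \<exists>\<pi>\<in>{\<pi> \<in> WD6. \<pi> 6 = 6}. acts_by m \<pi>"
  unfolding G_L_def
proof (erule generate_acts[rotated -1])
  have fix6: "signed flip12 6 = 6"
    "signed (Transposition.transpose 1 2 \<circ> Transposition.transpose 3 4) 6 = 6"
    "signed (Transposition.transpose 1 2) 6 = 6"
    "signed (Transposition.transpose 2 3) 6 = 6"
    "signed (Transposition.transpose 4 5) 6 = 6"
    by (simp_all add: signed_pos flip12_def Transposition.transpose_def)
  show "\<exists>\<pi>\<in>{\<pi> \<in> WD6. \<pi> 6 = 6}. acts_by g \<pi> \<and> \<pi> \<circ> \<pi> = id"
    if "g \<in> {swap_matrix 1 2, swap_matrix 2 3, swap_matrix 3 4, swap_matrix 6 7, A0}" for g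
    using that acts_by_generators signed_involution flip12_in_WD6 generators_permute[THEN signed_perm_in_WD6] fix6
    by (elim insertE emptyE; hypsubst; blast)
qed (auto simp: id_in_WD6 WD6_comp)

lemma realized_transpose:
  assumes "swap_matrix 2 3 \<in> G" "swap_matrix 3 4 \<in> G" "swap_matrix 6 7 \<in> G" "A0 \<in> G"
    and "1 \<le> a" "a < 6" "a = 5 \<Longrightarrow> swap_matrix 5 6 \<in> G"
  shows "signed (Transposition.transpose a (a + 1)) \<in> realized G"
proof -
  let ?t = "Transposition.transpose :: int \<Rightarrow> int \<Rightarrow> int \<Rightarrow> int"
  \<comment> \<open>\<^const>\<open>A0\<close> is not a reflection; its product with the transposition (34) is.\<close>
  have "signed (?t 1 2) \<circ> signed (?t 1 2 \<circ> ?t 3 4) = signed (?t 3 4)"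
    by (rule odd_eqI) (auto simp: signed_minus signed_pos Transposition.transpose_def)
  then have "signed (?t 3 4) \<in> realized G"
    using realized_comp[OF realized_incl[OF assms(2) acts_by_generators(2)]
        realized_incl[OF assms(4) acts_by_generators(4)]] by (simp only:)
  moreover have "a = 1 \<or> a = 2 \<or> a = 3 \<or> a = 4 \<or> a = 5" using assms(5,6) by auto
  ultimately show ?thesis
    using assms acts_by_generators by (elim disjE) (auto intro: realized_incl)
qed

lemma realized_M: "\<pi> \<in> WD6 \<Longrightarrow> \<exists>m\<in>M. acts_by m \<pi>"
proof -
  let ?G = "{swap_matrix 1 2, swap_matrix 2 3, swap_matrix 3 4, swap_matrix 5 6, swap_matrix 6 7, A0}"
  assume \<pi>: "\<pi> \<in> WD6"
  have "\<pi> \<in> realized ?G"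
  proof (rule WD6_generated[of _ 6])
    show "signed (Transposition.transpose a (a + 1)) \<in> realized ?G" if "1 \<le> a" "a < 6" for a
      by (rule realized_transpose) (use that in auto)
    show "signed flip12 \<in> realized ?G" by (rule realized_incl[OF _ acts_by_generators(1)]) simp
    show "\<pi> i = i" if "6 < i" for i
      using permutes_not_in[OF WD6_permutes[OF \<pi>], of i] that by (simp add: Idx_def)
  qed (use \<pi> in \<open>simp_all add: realized_id realized_comp\<close>)
  then show ?thesis by (auto simp: realized_def M_def)
qed

lemma realized_G_K:
  assumes \<pi>: "\<pi> \<in> WD6" "\<pi> ` {1..6} = {1..6}"
  shows "\<exists>m\<in>G_K. acts_by m \<pi>"
proof -
  let ?G = "{swap_matrix 2 3, swap_matrix 3 4, swap_matrix 5 6, swap_matrix 6 7, A0}"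
  have "\<pi> i = i" if "6 < i" for i
    using permutes_not_in[OF WD6_permutes[OF \<pi>(1)], of i] that by (simp add: Idx_def)
  then obtain \<sigma> where \<sigma>: "\<sigma> permutes {1..6}" "signed \<sigma> = \<pi>"
    using WD6_signed_perm[OF \<pi>] by blast
  have "signed \<sigma> \<in> realized ?G"
  proof (rule signed_perm_generated[of _ 6])
    show "signed (Transposition.transpose a (a + 1)) \<in> realized ?G" if "1 \<le> a" "a < 6" for a
      by (rule realized_transpose) (use that in auto)
  qed (simp_all add: realized_id realized_comp \<sigma>)
  then show ?thesis by (auto simp: realized_def G_K_def \<sigma>)
qed

lemma realized_G_L:
  assumes \<pi>: "\<pi> \<in> WD6" "\<pi> 6 = 6"
  shows "\<exists>m\<in>G_L. acts_by m \<pi>"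
proof -
  let ?G = "{swap_matrix 1 2, swap_matrix 2 3, swap_matrix 3 4, swap_matrix 6 7, A0}"
  have "\<pi> \<in> realized ?G"
  proof (rule WD6_generated[of _ 5])
    show "signed (Transposition.transpose a (a + 1)) \<in> realized ?G" if "1 \<le> a" "a < 5" for a
      by (rule realized_transpose) (use that in auto)
    show "signed flip12 \<in> realized ?G" by (rule realized_incl[OF _ acts_by_generators(1)]) simp
    show "\<pi> i = i" if "5 < i" for i
      using permutes_not_in[OF WD6_permutes[OF \<pi>(1)], of i] that \<pi>(2)
      by (cases "i = 6") (auto simp: Idx_def)
  qed (use \<pi> in \<open>simp_all add: realized_id realized_comp\<close>)
  then show ?thesis by (auto simp: realized_def G_L_def)
qed

definition perm_of :: "mat7 \<Rightarrow> int \<Rightarrow> int"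
  where "perm_of m = (THE \<pi>. \<pi> \<in> WD6 \<and> acts_by m \<pi>)"

lemma perm_eqI: "\<pi> \<in> WD6 \<Longrightarrow> acts_by m \<pi> \<Longrightarrow> perm_of m = \<pi>"
  unfolding perm_of_def by (rule the_equality) (auto intro: acts_by_unique)

lemma
  assumes "m \<in> M"
  shows perm_in_WD6: "perm_of m \<in> WD6" and acts_by_perm: "acts_by m (perm_of m)"
  using M_acts[OF assms] perm_eqI by auto

lemma perm_surj:
  assumes "\<pi> \<in> WD6"
  obtains m where "m \<in> M" "perm_of m = \<pi>"
  using realized_M[OF assms] perm_eqI[OF assms] by blast

lemma G_K_subset: "G_K \<subseteq> M"
  unfolding G_K_def M_def by (rule GL7.mono_generate) auto

lemma G_L_subset: "G_L \<subseteq> M"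
  unfolding G_L_def M_def by (rule GL7.mono_generate) auto

lemma G_K_eq: "G_K = {m \<in> M. perm_of m ` {1..6} = {1..6}}"
proof
  show "G_K \<subseteq> {m \<in> M. perm_of m ` {1..6} = {1..6}}"
  proof
    fix m assume m: "m \<in> G_K"
    then obtain \<pi> where "\<pi> \<in> WD6" "\<pi> ` {1..6} = {1..6}" "acts_by m \<pi>" using G_K_acts by blast
    then show "m \<in> {m \<in> M. perm_of m ` {1..6} = {1..6}}" using m G_K_subset perm_eqI by auto
  qed
  show "{m \<in> M. perm_of m ` {1..6} = {1..6}} \<subseteq> G_K"
  proof clarify
    fix m assume m: "m \<in> M" "perm_of m ` {1..6} = {1..6}"
    then obtain n where "n \<in> G_K" "acts_by n (perm_of m)" using realized_G_K[OF perm_in_WD6] by blast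
    then show "m \<in> G_K" using acts_by_inj[OF acts_by_perm[OF m(1)]] by blast
  qed
qed

lemma G_L_eq: "G_L = {m \<in> M. perm_of m 6 = 6}"
proof
  show "G_L \<subseteq> {m \<in> M. perm_of m 6 = 6}"
  proof
    fix m assume m: "m \<in> G_L"
    then obtain \<pi> where "\<pi> \<in> WD6" "\<pi> 6 = 6" "acts_by m \<pi>" using G_L_acts by blast
    then show "m \<in> {m \<in> M. perm_of m 6 = 6}" using m G_L_subset perm_eqI by auto
  qed
  show "{m \<in> M. perm_of m 6 = 6} \<subseteq> G_L"
  proof clarify
    fix m assume m: "m \<in> M" "perm_of m 6 = 6"
    then obtain n where "n \<in> G_L" "acts_by n (perm_of m)" using realized_G_L[OF perm_in_WD6] by blast
    then show "m \<in> G_L" using acts_by_inj[OF acts_by_perm[OF m(1)]] by blast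
  qed
qed

lemma subgroup_generate:
  assumes "\<And>g. g \<in> G \<Longrightarrow> \<exists>\<pi>. acts_by g \<pi> \<and> \<pi> \<circ> \<pi> = id"
  shows "subgroup (generate GL7 G) GL7"
proof (rule GL7.generate_is_subgroup)
  show "G \<subseteq> carrier GL7"
  proof
    fix g assume "g \<in> G"
    then have "g ** g = mat 1" using assms acts_by_involution by blast
    then show "g \<in> carrier GL7" by (auto simp: GL7_simps invertible_def)
  qed
qed

lemma subgroups: "subgroup M GL7" "subgroup G_K GL7" "subgroup G_L GL7"
  unfolding M_def G_K_def G_L_def
  by (rule subgroup_generate; elim insertE emptyE; hypsubst;
      use acts_by_generators signed_involution in blast)+

interpretation Mg: group M_group
  unfolding M_group_def by (rule GL7.subgroup_imp_group[OF subgroups(1)])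

lemma M_group_simps: "carrier M_group = M" "A \<otimes>\<^bsub>M_group\<^esub> B = A ** B" "\<one>\<^bsub>M_group\<^esub> = mat 1"
  by (simp_all add: M_group_def GL7_def)

lemma subgroup_K: "subgroup G_K M_group" and subgroup_L: "subgroup G_L M_group"
  unfolding M_group_def
  using subgroups G_K_subset G_L_subset by (auto intro!: GL7.subgroup_incl)

lemma M_mult: "m \<in> M \<Longrightarrow> m' \<in> M \<Longrightarrow> m ** m' \<in> M"
  using Mg.m_closed by (simp add: M_group_simps)

lemma perm_mult: "m \<in> M \<Longrightarrow> m' \<in> M \<Longrightarrow> perm_of (m ** m') = perm_of m' \<circ> perm_of m"
  by (intro perm_eqI WD6_comp acts_by_mult perm_in_WD6 acts_by_perm)

lemma perm_one: "perm_of (mat 1) = id"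
  by (rule perm_eqI[OF id_in_WD6 acts_by_id])

definition coset_L_of :: "int \<Rightarrow> mat7 set" where "coset_L_of i = {m \<in> M. perm_of m 6 = i}"
definition coset_K_of :: "int set \<Rightarrow> mat7 set" where "coset_K_of T = {m \<in> M. perm_of m ` {1..6} = T}"

lemma quotient_perm:
  assumes "x \<in> M" "y \<in> M"
  shows "x \<otimes>\<^bsub>M_group\<^esub> inv\<^bsub>M_group\<^esub> y \<in> M" "perm_of x = perm_of y \<circ> perm_of (x \<otimes>\<^bsub>M_group\<^esub> inv\<^bsub>M_group\<^esub> y)"
proof -
  let ?z = "x \<otimes>\<^bsub>M_group\<^esub> inv\<^bsub>M_group\<^esub> y"
  show z: "?z \<in> M"
    using assms Mg.m_closed[of x "inv\<^bsub>M_group\<^esub> y"] Mg.inv_closed[of y]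
    unfolding M_group_simps(1) by blast
  have "?z \<otimes>\<^bsub>M_group\<^esub> y = x"
    using assms Mg.inv_solve_right[of ?z x y] z by (simp add: M_group_simps(1))
  then have "x = ?z ** y" unfolding M_group_simps(2)[of ?z] by simp
  then show "perm_of x = perm_of y \<circ> perm_of ?z" using perm_mult[OF z assms(2)] by simp
qed

lemma coset_L:
  assumes "m \<in> M"
  shows "G_L #>\<^bsub>M_group\<^esub> m = coset_L_of (perm_of m 6)"
proof -
  have "x \<in> G_L #>\<^bsub>M_group\<^esub> m \<longleftrightarrow> perm_of x 6 = perm_of m 6" if x: "x \<in> M" for x
  proof -
    have "x \<in> G_L #>\<^bsub>M_group\<^esub> m \<longleftrightarrow> x \<otimes>\<^bsub>M_group\<^esub> inv\<^bsub>M_group\<^esub> m \<in> G_L"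
      using x assms by (intro subgroup.rcos_module[OF subgroup_L Mg.is_group]) (simp_all add: M_group_simps)
    also have "\<dots> \<longleftrightarrow> perm_of x 6 = perm_of m 6"
      using quotient_perm[OF x assms] WD6_eq_iff[OF perm_in_WD6[OF assms]] by (simp add: G_L_eq)
    finally show ?thesis .
  qed
  moreover have "G_L #>\<^bsub>M_group\<^esub> m \<subseteq> M"
    using Mg.r_coset_subset_G[of G_L m] G_L_subset assms by (simp add: M_group_simps)
  ultimately show ?thesis by (auto simp: coset_L_of_def)
qed

lemma coset_K:
  assumes "m \<in> M"
  shows "G_K #>\<^bsub>M_group\<^esub> m = coset_K_of (perm_of m ` {1..6})"
proof -
  have "x \<in> G_K #>\<^bsub>M_group\<^esub> m \<longleftrightarrow> perm_of x ` {1..6} = perm_of m ` {1..6}" if x: "x \<in> M" for x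
  proof -
    have "x \<in> G_K #>\<^bsub>M_group\<^esub> m \<longleftrightarrow> x \<otimes>\<^bsub>M_group\<^esub> inv\<^bsub>M_group\<^esub> m \<in> G_K"
      using x assms by (intro subgroup.rcos_module[OF subgroup_K Mg.is_group]) (simp_all add: M_group_simps)
    also have "\<dots> \<longleftrightarrow> perm_of x ` {1..6} = perm_of m ` {1..6}"
      unfolding quotient_perm(2)[OF x assms] image_comp[symmetric]
      using quotient_perm(1)[OF x assms] inj_image_eq_iff[OF WD6_inj_on[OF perm_in_WD6[OF assms]]]
      by (simp add: G_K_eq)
    finally show ?thesis .
  qed
  moreover have "G_K #>\<^bsub>M_group\<^esub> m \<subseteq> M"
    using Mg.r_coset_subset_G[of G_K m] G_K_subset assms by (simp add: M_group_simps)
  ultimately show ?thesis by (auto simp: coset_K_of_def)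
qed

lemma WD6_transitive:
  assumes "i \<in> Idx"
  obtains \<pi> where "\<pi> \<in> WD6" "\<pi> 6 = i"
proof -
  let ?\<sigma> = "signed (Transposition.transpose 6 \<bar>i\<bar>)" and ?\<nu> = "signed (negate {1..6})"
  have "\<bar>i\<bar> \<in> {1..6}" using assms abs_in_iff by blast
  then have \<sigma>: "?\<sigma> \<in> WD6" "?\<sigma> 6 = \<bar>i\<bar>"
    by (auto intro!: signed_perm_in_WD6 permutes_swap_id simp: signed_pos)
  have \<nu>: "?\<nu> \<in> WD6" "?\<nu> 6 = - 6"
    using signed_negate_in_WD6[of "{1..6}"] by (auto simp: signed_pos negate_def)
  show thesis
  proof (cases "i > 0")
    case True
    then show thesis using that[OF \<sigma>(1)] \<sigma>(2) by simp
  next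
    case False
    then show thesis using that[OF WD6_comp[OF \<sigma>(1) \<nu>(1)]] \<sigma> \<nu>(2) by (simp add: WD6_minus)
  qed
qed

lemma M_transitive:
  assumes "i \<in> Idx"
  obtains m where "m \<in> M" "perm_of m 6 = i"
proof -
  obtain \<pi> where "\<pi> \<in> WD6" "\<pi> 6 = i" by (rule WD6_transitive[OF assms])
  moreover from this(1) obtain m where "m \<in> M" "perm_of m = \<pi>" by (rule perm_surj)
  ultimately show thesis using that[of m] by simp
qed

lemma M_transitive_spins:
  assumes "T \<in> spins"
  obtains m where "m \<in> M" "perm_of m ` {1..6} = T"
proof -
  obtain \<pi> where "\<pi> \<in> WD6" "T = \<pi> ` {1..6}" by (rule spinsE[OF assms])
  moreover from this(1) obtain m where "m \<in> M" "perm_of m = \<pi>" by (rule perm_surj)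
  ultimately show thesis using that[of m] by simp
qed

lemma rcosets_L: "rcosets\<^bsub>M_group\<^esub> G_L = coset_L_of ` Idx"
proof -
  have "perm_of m 6 \<in> Idx" if "m \<in> M" for m
    using WD6_in_Idx[OF perm_in_WD6[OF that], of 6] by (simp add: Idx_def)
  moreover have "i \<in> (\<lambda>m. perm_of m 6) ` M" if "i \<in> Idx" for i
    using M_transitive[OF that] by blast
  ultimately have "(\<lambda>m. perm_of m 6) ` M = Idx" by blast
  moreover have "rcosets\<^bsub>M_group\<^esub> G_L = (\<lambda>m. coset_L_of (perm_of m 6)) ` M"
    by (auto simp: RCOSETS_def M_group_simps(1) coset_L)
  ultimately show ?thesis by (metis image_image)
qed

lemma rcosets_K: "rcosets\<^bsub>M_group\<^esub> G_K = coset_K_of ` spins"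
proof -
  have "T \<in> (\<lambda>m. perm_of m ` {1..6}) ` M" if "T \<in> spins" for T
    using M_transitive_spins[OF that] by blast
  then have "(\<lambda>m. perm_of m ` {1..6}) ` M = spins"
    using WD6_spins[OF perm_in_WD6] by blast
  moreover have "rcosets\<^bsub>M_group\<^esub> G_K = (\<lambda>m. coset_K_of (perm_of m ` {1..6})) ` M"
    by (auto simp: RCOSETS_def M_group_simps(1) coset_K)
  ultimately show ?thesis by (metis image_image)
qed

lemma cosL_mult:
  assumes "i \<in> Idx" "m \<in> M"
  shows "coset_L_of i #>\<^bsub>M_group\<^esub> m = coset_L_of (perm_of m i)"
proof -
  obtain n where n: "n \<in> M" "perm_of n 6 = i" using M_transitive[OF assms(1)] .
  have "coset_L_of i #>\<^bsub>M_group\<^esub> m = G_L #>\<^bsub>M_group\<^esub> n #>\<^bsub>M_group\<^esub> m"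
    using n coset_L by simp
  also have "\<dots> = G_L #>\<^bsub>M_group\<^esub> (n ** m)"
    using Mg.coset_mult_assoc[of G_L n m] n assms G_L_subset by (simp add: M_group_simps)
  also have "\<dots> = coset_L_of (perm_of m i)"
    using n assms by (simp add: coset_L M_mult perm_mult)
  finally show ?thesis .
qed

lemma cosK_mult:
  assumes "T \<in> spins" "m \<in> M"
  shows "coset_K_of T #>\<^bsub>M_group\<^esub> m = coset_K_of (perm_of m ` T)"
proof -
  obtain n where n: "n \<in> M" "perm_of n ` {1..6} = T" using M_transitive_spins[OF assms(1)] .
  have "coset_K_of T #>\<^bsub>M_group\<^esub> m = G_K #>\<^bsub>M_group\<^esub> n #>\<^bsub>M_group\<^esub> m"
    using n coset_K by simp
  also have "\<dots> = G_K #>\<^bsub>M_group\<^esub> (n ** m)"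
    using Mg.coset_mult_assoc[of G_K n m] n assms G_K_subset by (simp add: M_group_simps)
  also have "\<dots> = coset_K_of (perm_of m ` T)"
    using n assms by (simp add: coset_K M_mult perm_mult image_comp[symmetric] del: comp_apply)
  finally show ?thesis .
qed

lemma inj_coset_L_of: "inj_on coset_L_of Idx"
proof (rule inj_onI)
  fix i j assume i: "i \<in> Idx" and eq: "coset_L_of i = coset_L_of j"
  obtain m where "m \<in> M" "perm_of m 6 = i" by (rule M_transitive[OF i])
  then have "m \<in> coset_L_of j" unfolding eq[symmetric] by (simp add: coset_L_of_def)
  then show "i = j" using \<open>perm_of m 6 = i\<close> by (simp add: coset_L_of_def)
qed

lemma inj_coset_K_of: "inj_on coset_K_of spins"
proof (rule inj_onI)
  fix T U assume T: "T \<in> spins" and eq: "coset_K_of T = coset_K_of U"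
  obtain m where "m \<in> M" "perm_of m ` {1..6} = T" by (rule M_transitive_spins[OF T])
  then have "m \<in> coset_K_of U" unfolding eq[symmetric] by (simp add: coset_K_of_def)
  then show "T = U" using \<open>perm_of m ` {1..6} = T\<close> by (simp add: coset_K_of_def)
qed

section \<open>Transfer to cosets\<close>

definition cosets_of :: "int set \<times> int set \<Rightarrow> mat7 set \<times> mat7 set set"
  where "cosets_of z = (coset_K_of (fst z), coset_L_of ` snd z)"

lemma inj_cosets_of: "inj_on cosets_of (spins \<times> Pow Idx)"
proof (rule inj_onI)
  fix y z assume "y \<in> spins \<times> Pow Idx" "z \<in> spins \<times> Pow Idx" "cosets_of y = cosets_of z"
  then show "y = z"
    using inj_onD[OF inj_coset_K_of, of "fst y" "fst z"] inj_on_image_eq_iff[OF inj_coset_L_of, of "snd y" "snd z"]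
    by (auto simp: cosets_of_def prod_eq_iff)
qed

lemma cosets_of_Times: "cosets_of ` (A \<times> B) = coset_K_of ` A \<times> (`) coset_L_of ` B"
proof
  show "coset_K_of ` A \<times> (`) coset_L_of ` B \<subseteq> cosets_of ` (A \<times> B)"
  proof clarify
    fix T X assume "T \<in> A" "X \<in> B"
    then show "(coset_K_of T, coset_L_of ` X) \<in> cosets_of ` (A \<times> B)"
      by (intro image_eqI[of _ _ "(T, X)"]) (simp_all add: cosets_of_def)
  qed
qed (auto simp: cosets_of_def)

lemma S_K_L2_eq: "S_K_L2 = cosets_of ` (spins \<times> {X. X \<subseteq> Idx \<and> card X = 2})"
proof -
  have "S_L2 = (`) coset_L_of ` {X. X \<subseteq> Idx \<and> card X = 2}"
  proof
    show "(`) coset_L_of ` {X. X \<subseteq> Idx \<and> card X = 2} \<subseteq> S_L2"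
      by (auto simp: S_L2_def rcosets_L card_image inj_on_subset[OF inj_coset_L_of])
    show "S_L2 \<subseteq> (`) coset_L_of ` {X. X \<subseteq> Idx \<and> card X = 2}"
    proof
      fix Q assume Q: "Q \<in> S_L2"
      then obtain X where X: "X \<subseteq> Idx" "Q = coset_L_of ` X"
        by (auto simp: S_L2_def rcosets_L subset_image_iff)
      then have "card X = 2"
        using Q by (simp add: S_L2_def card_image inj_on_subset[OF inj_coset_L_of])
      then show "Q \<in> (`) coset_L_of ` {X. X \<subseteq> Idx \<and> card X = 2}" using X by blast
    qed
  qed
  then show ?thesis
    by (simp add: S_K_L2_def rcosets_K cosets_of_Times)
qed

lemma right_mult_emb:
  assumes "m \<in> M" "z \<in> spins \<times> Pow Idx"
  shows "right_mult m (cosets_of z) = cosets_of (act (perm_of m) z)"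
proof -
  have "(\<lambda>q. q #>\<^bsub>M_group\<^esub> m) ` coset_L_of ` snd z = coset_L_of ` perm_of m ` snd z"
    unfolding image_image using assms by (intro image_cong) (auto simp: cosL_mult)
  then show ?thesis
    using assms by (auto simp: right_mult_def cosets_of_def act_def cosK_mult mem_Times_iff)
qed

lemma perm_image_M: "perm_of ` M = WD6"
proof
  show "perm_of ` M \<subseteq> WD6" using perm_in_WD6 by blast
  show "WD6 \<subseteq> perm_of ` M"
  proof
    fix \<pi> assume "\<pi> \<in> WD6"
    then obtain m where "m \<in> M" "perm_of m = \<pi>" by (rule perm_surj)
    then show "\<pi> \<in> perm_of ` M" by blast
  qed
qed

lemma M_orbit_emb:
  assumes "z \<in> spins \<times> Pow Idx"
  shows "M_orbit (cosets_of z) = cosets_of ` orb z"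
proof -
  have "M_orbit (cosets_of z) = (\<lambda>m. right_mult m (cosets_of z)) ` M"
    by (auto simp: M_orbit_def orbit_def M_group_simps(1))
  also have "\<dots> = (\<lambda>m. cosets_of (act (perm_of m) z)) ` M"
    using assms by (intro image_cong) (auto simp: right_mult_emb)
  also have "\<dots> = cosets_of ` orb z"
    by (simp add: orb_def image_image flip: perm_image_M)
  finally show ?thesis .
qed

lemma act_comp: "act \<sigma> (act \<pi> z) = act (\<sigma> \<circ> \<pi>) z"
  by (simp add: act_def image_image)

lemma act_id: "act id z = z"
  by (simp add: act_def)

lemma WD6_left_inverse:
  assumes "\<pi> \<in> WD6"
  obtains \<sigma> where "\<sigma> \<in> WD6" "\<sigma> \<circ> \<pi> = id"
proof -
  obtain m where m: "m \<in> M" "perm_of m = \<pi>" by (rule perm_surj[OF assms])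
  let ?n = "inv\<^bsub>M_group\<^esub> m"
  have n: "?n \<in> M" "m ** ?n = mat 1"
    using Mg.inv_closed[of m] Mg.r_inv[of m] m(1) by (simp_all only: M_group_simps)
  have "perm_of ?n \<circ> \<pi> = id"
    using perm_mult[OF m(1) n(1)] n(2) m(2) perm_one by simp
  then show thesis using that perm_in_WD6[OF n(1)] by blast
qed

lemma orb_eq:
  assumes "z \<in> orb r"
  shows "orb z = orb r"
proof -
  obtain \<pi> where \<pi>: "\<pi> \<in> WD6" "z = act \<pi> r" using assms by (auto simp: orb_def)
  obtain \<sigma> where \<sigma>: "\<sigma> \<in> WD6" "\<sigma> \<circ> \<pi> = id" by (rule WD6_left_inverse[OF \<pi>(1)])
  have r: "r = act \<sigma> z" using \<pi>(2) \<sigma>(2) by (simp only: act_comp act_id)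
  have sub: "orb (act \<tau> y) \<subseteq> orb y" if \<tau>: "\<tau> \<in> WD6" for \<tau> y
  proof -
    have "act \<rho> (act \<tau> y) \<in> orb y" if "\<rho> \<in> WD6" for \<rho>
      unfolding act_comp orb_def using WD6_comp[OF that \<tau>] by blast
    then show ?thesis unfolding orb_def[of "act \<tau> y"] by blast
  qed
  have "orb z \<subseteq> orb r" using sub[OF \<pi>(1), of r] \<pi>(2) by simp
  moreover have "orb r \<subseteq> orb z" using sub[OF \<sigma>(1), of z] r by simp
  ultimately show ?thesis by blast
qed

lemma orb_self: "z \<in> orb z"
  unfolding orb_def by (rule image_eqI[of _ _ id]) (simp_all add: act_id id_in_WD6)

lemma orb_subset:
  assumes "z \<in> spins \<times> Pow Idx"
  shows "orb z \<subseteq> spins \<times> Pow Idx"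
proof -
  have "act \<pi> z \<in> spins \<times> Pow Idx" if "\<pi> \<in> WD6" for \<pi>
    using assms WD6_image_spins[OF that] WD6_in_Idx[OF that]
    by (auto simp: act_def mem_Times_iff)
  then show ?thesis unfolding orb_def by blast
qed

lemma labelled_coset_eq:
  assumes "\<pi> \<in> WD6"
    and "\<And>x. x \<in> V \<Longrightarrow> level_form (label_map l x) = 1"
    and "\<And>i x. x \<in> V \<Longrightarrow> i \<in> {1..6} \<Longrightarrow> axis_form i (label_map l x) = axis_form (\<pi> i) x"
  shows "labelled_coset l = coset_L_of (\<pi> 6)"
proof -
  obtain m where m: "m \<in> M" "perm_of m = \<pi>" by (rule perm_surj[OF assms(1)])
  have act: "acts_by m \<pi>" using acts_by_perm[OF m(1)] m(2) by simp
  have V: "x \<in> V \<longleftrightarrow> level_form x = 1" for x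
    by (simp add: V_def level_form_def on_coords_def)
  have on_V: "m *v x = label_map l x" if "x \<in> V" for x
    using act assms(2,3)[OF that] that by (intro vec7_eqI) (simp_all add: acts_by_def V)
  have "M_element (label_map l) = m"
    unfolding M_element_def
  proof (rule the_equality)
    show "m \<in> M \<and> (\<forall>x\<in>V. m *v x = label_map l x)" using m(1) on_V by blast
    fix n assume n: "n \<in> M \<and> (\<forall>x\<in>V. n *v x = label_map l x)"
    have "base_point \<in> V" by (simp add: V level_form_base_point)
    then have "n *v base_point = m *v base_point" using n on_V by simp
    then have "perm_of n = \<pi>"
      using n acts_by_unique[OF perm_in_WD6 assms(1) acts_by_perm act] by blast
    then show "n = m" using n acts_by_perm[of n] acts_by_inj[OF _ act] by simp
  qed
  then show ?thesis using coset_L[OF m(1)] m(2) by (simp add: labelled_coset_def)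
qed

text \<open>Read off from \<open>axis_form k (label_map l x)\<close> for \<open>x\<close> in \<^const>\<open>V\<close>.\<close>

definition bar1_perm :: "int \<Rightarrow> int" where
  "bar1_perm k = (if k = 1 then - 4 else if k = 2 then - 5 else if k = 3 then - 6
     else if k = 4 then - 3 else if k = 5 then - 2 else if k = 6 then - 1 else k)"

definition bar2_perm :: "int \<Rightarrow> int" where
  "bar2_perm k = (if k = 1 then - 4 else if k = 2 then - 5 else if k = 3 then - 6
     else if k = 4 then - 1 else if k = 5 then - 3 else if k = 6 then - 2 else k)"

lemma labelled_cosets:
  "labelled_coset Lab6 = coset_L_of 6" "labelled_coset Lab5 = coset_L_of 5" "labelled_coset Bar6 = coset_L_of (- 6)"
  "labelled_coset Bar1 = coset_L_of (- 1)" "labelled_coset Bar2 = coset_L_of (- 2)"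
proof -
  have set6: "{1..6} = {1, 2, 3, 4, 5, 6 :: int}" by auto
  have V_one: "x $ 5 = 1 + x $ 1 + x $ 2 + x $ 3 + x $ 4 - x $ 6 - x $ 7" if "x \<in> V" for x
    using that by (simp add: V_def on_coords_def algebra_simps)
  note calc = level_form_def axis_form_def on_coords_def vector_7 V_one
  have cases6: "i = 1 \<or> i = 2 \<or> i = 3 \<or> i = 4 \<or> i = 5 \<or> i = 6" if "i \<in> {1..6}" for i :: int
    using that by auto
  show "labelled_coset Lab6 = coset_L_of 6"
    using labelled_coset_eq[OF id_in_WD6, of Lab6] by (simp add: calc)
  have "signed (Transposition.transpose 5 6) \<in> WD6"
    by (intro signed_perm_in_WD6 permutes_swap_id) auto
  then have "labelled_coset Lab5 = coset_L_of (signed (Transposition.transpose 5 6) 6)"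
    by (rule labelled_coset_eq)
      (auto dest!: cases6 simp: calc signed_pos Transposition.transpose_def)
  then show "labelled_coset Lab5 = coset_L_of 5" by (simp add: signed_pos)
  have "signed (negate {1..6}) \<in> WD6" by (rule signed_negate_in_WD6) auto
  then have "labelled_coset Bar6 = coset_L_of (signed (negate {1..6}) 6)"
    by (rule labelled_coset_eq)
      (auto dest!: cases6 simp: calc signed_pos negate_def)
  then show "labelled_coset Bar6 = coset_L_of (- 6)" by (simp add: signed_pos negate_def)
  have "signed bar1_perm \<in> WD6"
    by (rule signed_in_WD6) (auto simp: set6 bar1_perm_def)
  then have "labelled_coset Bar1 = coset_L_of (signed bar1_perm 6)"
    by (rule labelled_coset_eq)
      (auto dest!: cases6 simp: calc signed_pos bar1_perm_def)
  then show "labelled_coset Bar1 = coset_L_of (- 1)" by (simp add: signed_pos bar1_perm_def)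
  have "signed bar2_perm \<in> WD6"
    by (rule signed_in_WD6) (auto simp: set6 bar2_perm_def)
  then have "labelled_coset Bar2 = coset_L_of (signed bar2_perm 6)"
    by (rule labelled_coset_eq)
      (auto dest!: cases6 simp: calc signed_pos bar2_perm_def)
  then show "labelled_coset Bar2 = coset_L_of (- 2)" by (simp add: signed_pos bar2_perm_def)
qed

lemma p0_eq: "p0 = coset_K_of {1..6}"
  by (simp add: p0_def G_K_eq coset_K_of_def)

theorem proposition4p4:
  shows "card M_orbits = 4
    \<and> {(p0, {labelled_coset Lab6, labelled_coset Lab5}),
       (p0, {labelled_coset Bar6, labelled_coset Lab5}),
       (p0, {labelled_coset Lab6, labelled_coset Bar6}),
       (p0, {labelled_coset Bar1, labelled_coset Bar2})} \<subseteq> S_K_L2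
    \<and> M_orbits =
       {M_orbit (p0, {labelled_coset Lab6, labelled_coset Lab5}),
        M_orbit (p0, {labelled_coset Bar6, labelled_coset Lab5}),
        M_orbit (p0, {labelled_coset Lab6, labelled_coset Bar6}),
        M_orbit (p0, {labelled_coset Bar1, labelled_coset Bar2})}
    \<and> card (M_orbit (p0, {labelled_coset Lab6, labelled_coset Lab5})) = 480
    \<and> card (M_orbit (p0, {labelled_coset Bar6, labelled_coset Lab5})) = 960
    \<and> card (M_orbit (p0, {labelled_coset Lab6, labelled_coset Bar6})) = 192
    \<and> card (M_orbit (p0, {labelled_coset Bar1, labelled_coset Bar2})) = 480"
proof -
  define r1 r2 r3 r4 where r_defs: "r1 = ({1..6::int}, {6, 5::int})" "r2 = ({1..6::int}, {- 6, 5::int})"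
    "r3 = ({1..6::int}, {6, - 6::int})" "r4 = ({1..6::int}, {- 1, - 2::int})"
  let ?D = "spins \<times> {X. X \<subseteq> Idx \<and> card X = 2}"
  have reps: "(p0, {labelled_coset Lab6, labelled_coset Lab5}) = cosets_of r1"
    "(p0, {labelled_coset Bar6, labelled_coset Lab5}) = cosets_of r2"
    "(p0, {labelled_coset Lab6, labelled_coset Bar6}) = cosets_of r3"
    "(p0, {labelled_coset Bar1, labelled_coset Bar2}) = cosets_of r4"
    by (simp_all add: cosets_of_def p0_eq labelled_cosets r_defs)
  have D: "{r1, r2, r3, r4} \<subseteq> ?D"
    using positive_spin by (auto simp: r_defs Idx_def)
  have DS: "?D \<subseteq> spins \<times> Pow Idx" by auto
  have orbits: "M_orbit (cosets_of z) = cosets_of ` orb z" if "z \<in> ?D" for z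
    using that DS by (intro M_orbit_emb) blast
  have card: "card (M_orbit (cosets_of z)) = card (orb z)" if "z \<in> ?D" for z
  proof -
    have "inj_on cosets_of (orb z)"
      using inj_on_subset[OF inj_cosets_of orb_subset[of z]] that by auto
    then show ?thesis using orbits[OF that] by (simp add: card_image)
  qed
  have cards: "card (M_orbit (cosets_of r1)) = 480" "card (M_orbit (cosets_of r2)) = 960"
    "card (M_orbit (cosets_of r3)) = 192" "card (M_orbit (cosets_of r4)) = 480"
    using card_orb D by (simp_all add: card r_defs)
  have M_orbits: "M_orbits = {M_orbit (cosets_of r1), M_orbit (cosets_of r2), M_orbit (cosets_of r3), M_orbit (cosets_of r4)}"
  proof -
    have eq: "M_orbits = (\<lambda>z. M_orbit (cosets_of z)) ` ?D"
      by (simp only: M_orbits_def M_orbit_def orbits_def S_K_L2_eq image_image Setcompr_eq_image)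
    have "M_orbit (cosets_of z) \<in> {M_orbit (cosets_of r1), M_orbit (cosets_of r2), M_orbit (cosets_of r3), M_orbit (cosets_of r4)}"
      if z: "z \<in> ?D" for z
    proof -
      have "z \<in> orb r1 \<union> orb r2 \<union> orb r3 \<union> orb r4"
        using orbs_cover[of "fst z" "snd z"] z by (auto simp: r_defs)
      then have "orb z \<in> {orb r1, orb r2, orb r3, orb r4}"
        using orb_eq by blast
      then show ?thesis using z D orbits by auto
    qed
    then have "M_orbits \<subseteq> {M_orbit (cosets_of r1), M_orbit (cosets_of r2), M_orbit (cosets_of r3), M_orbit (cosets_of r4)}"
      unfolding eq by (rule image_subsetI)
    moreover have "(\<lambda>z. M_orbit (cosets_of z)) ` {r1, r2, r3, r4} \<subseteq> M_orbits"
      unfolding eq by (rule image_mono[OF D])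
    ultimately show ?thesis by auto
  qed
  have "r1 \<notin> orb r4"
    unfolding r_defs orb_bar12 by auto
  then have "orb r1 \<noteq> orb r4" using orb_self[of r1] by auto
  moreover have "orb r1 \<subseteq> spins \<times> Pow Idx" "orb r4 \<subseteq> spins \<times> Pow Idx"
    using orb_subset D DS by auto
  ultimately have "M_orbit (cosets_of r1) \<noteq> M_orbit (cosets_of r4)"
    using D orbits inj_on_image_eq_iff[OF inj_cosets_of] by simp
  moreover have "M_orbit (cosets_of r1) \<noteq> M_orbit (cosets_of r2)" "M_orbit (cosets_of r1) \<noteq> M_orbit (cosets_of r3)"
    "M_orbit (cosets_of r2) \<noteq> M_orbit (cosets_of r3)" "M_orbit (cosets_of r2) \<noteq> M_orbit (cosets_of r4)"
    "M_orbit (cosets_of r3) \<noteq> M_orbit (cosets_of r4)"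
    using cards by auto
  ultimately have "card M_orbits = 4" by (simp add: M_orbits)
  moreover have "{cosets_of r1, cosets_of r2, cosets_of r3, cosets_of r4} \<subseteq> S_K_L2"
    using D by (auto simp: S_K_L2_eq)
  ultimately show ?thesis
    unfolding reps using M_orbits cards by blast
qed

end
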